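(* Suppose that, together with an instance with conflict graph $G=(V,E)$ on $m$ machines, a $\frac1\gamma$-approximate maximum independent set of $G$ is given, i.e. an independent set $\mathcal{I}\subseteq V$ with $|\mathcal{I}|\ge \alpha_1(G)/\gamma$, where $\gamma\ge 1$ and $\alpha_1(G)$ is the maximum cardinality of an independent set of $G$. Then there exists (i) a $\lceil\gamma\rceil$-approximation for SMC-PROP-I; (ii) a $\lceil\gamma\rceil$-approximation for SMC-PROP-II; and (iii) a $\left(\gamma+1-\frac1m\right)$-approximation for SMC-PROP-III.
   Context: An instance of SchedulingWithMachineConflicts (SMC) consists of a finite set $\mathcal{J}$ of jobs, $n=|\mathcal{J}|$, and a finite simple conflict graph $G=(V,E)$ whose vertices are the $m=|V|$ machines; machines $i,i'$ are in conflict iff $\{i,i'\}\in E$. Each job $j$ has three nonnegative parameters $(\overleftarrow{b}_j,p_j,\overrightarrow{b}_j)$: first blocking time, processing time, second blocking time; its system time is $q_j=\overleftarrow{b}_j+p_j+\overrightarrow{b}_j$. A (conflict-free) schedule $\Pi$ assigns to each job $j$ a machine and a starting time $S_j^\Pi\ge 0$; $C_j^\Pi=S_j^\Pi+q_j$ is its completion time and $j$ occupies its machine, without preemption, during $(S_j^\Pi,C_j^\Pi)$; its blocking intervals are $[S_j^\Pi,S_j^\Pi+\overleftarrow{b}_j]$ and $[C_j^\Pi-\overrightarrow{b}_j,C_j^\Pi]$. Requirements: each machine executes at most one job at any time, and for any two jobs on machines $i,i'$ with $\{i,i'\}\in E$, no blocking interval of one overlaps interiorly with a blocking interval of the other. The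 makespan is $\|\Pi\|=\max_j C_j^\Pi$, to be minimized. SMC-PROP-I, SMC-PROP-II, SMC-PROP-III are SMC restricted to instances satisfying, respectively: (PROP-I) all jobs are identical, $(\overleftarrow{b}_j,p_j,\overrightarrow{b}_j)=(\overleftarrow{b},p,\overrightarrow{b})$, and $\max\{\overleftarrow{b},\overrightarrow{b}\}>p$; (PROP-II) all jobs have equal system time $q_j=q$, and $\overleftarrow{b}_j>p_j$ and $\overrightarrow{b}_j>p_j$ for every job $j$; (PROP-III) for all jobs $j,j'$, $\overleftarrow{b}_j>p_{j'}$ and $\overrightarrow{b}_j>p_{j'}$. An $r$-approximation is a polynomial-time algorithm that outputs a conflict-free schedule of makespan at most $r$ times the minimum makespan. *)

theory Defs
  imports Complex_Main "HOL-Library.Ramsey" "HOL-Library.Log_Nat"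
    "HOL-Computational_Algebra.Polynomial"
begin

section \<open>Scheduling with machine conflicts\<close>

text \<open>
  Jobs and machines are numbered: the jobs are \<open>{..<num_jobs I}\<close>, and the vertices of the conflict
  graph are the machines \<open>{..<num_machines I}\<close>. Parameters are rational so that an instance
  has a finite encoding; starting times of schedules are arbitrary nonnegative reals.
\<close>

record smc_instance =
  num_jobs :: nat
  num_machines :: nat
  conflicts :: "nat set set"
  first_block :: "nat \<Rightarrow> rat"
  proc :: "nat \<Rightarrow> rat"
  second_block :: "nat \<Rightarrow> rat"

definition jobs :: "smc_instance \<Rightarrow> nat set" where
  "jobs I = {..<num_jobs I}"

definition machines :: "smc_instance \<Rightarrow> nat set" where
  "machines I = {..<num_machines I}"

definition smc :: "smc_instance \<Rightarrow> bool" where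
  "smc I \<longleftrightarrow> num_machines I \<ge> 1
     \<and> (\<forall>e\<in>conflicts I. e \<subseteq> machines I \<and> card e = 2)
     \<and> (\<forall>j\<in>jobs I. first_block I j \<ge> 0 \<and> proc I j \<ge> 0 \<and> second_block I j \<ge> 0)"

definition system_time :: "smc_instance \<Rightarrow> nat \<Rightarrow> rat" where
  "system_time I j = first_block I j + proc I j + second_block I j"

definition prop_I :: "smc_instance \<Rightarrow> bool" where
  "prop_I I \<longleftrightarrow> (\<exists>b p b'. max b b' > p \<and>
     (\<forall>j\<in>jobs I. first_block I j = b \<and> proc I j = p \<and> second_block I j = b'))"

definition prop_II :: "smc_instance \<Rightarrow> bool" where
  "prop_II I \<longleftrightarrow> (\<exists>q. \<forall>j\<in>jobs I. system_time I j = q) \<and>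
     (\<forall>j\<in>jobs I. first_block I j > proc I j \<and> second_block I j > proc I j)"

definition prop_III :: "smc_instance \<Rightarrow> bool" where
  "prop_III I \<longleftrightarrow>
     (\<forall>j\<in>jobs I. \<forall>k\<in>jobs I. first_block I j > proc I k \<and> second_block I j > proc I k)"

record schedule =
  machine :: "nat \<Rightarrow> nat"
  start :: "nat \<Rightarrow> real"

definition completion :: "smc_instance \<Rightarrow> schedule \<Rightarrow> nat \<Rightarrow> real" where
  "completion I \<sigma> j = start \<sigma> j + of_rat (system_time I j)"

text \<open>
  A pair \<open>(a, b)\<close> with \<open>a \<le> b\<close> stands for the closed interval from \<open>a\<close> to \<open>b\<close>. Two intervals
  overlap interiorly if the interior of one of them meets the other. For intervals of positive
  length this says that the interiors intersect (lemma \<open>overlap_interiorly_iff\<close>). The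
  formulation matters only for a blocking time equal to 0, whose blocking interval is a single
  point: this point must not lie strictly inside a blocking interval on a conflicting machine.
  If such points were ignored, then for property I with parameters \<open>(b, p, 0)\<close>, \<open>b > p > 0\<close>,
  conflicting machines could work in parallel, and a schedule of makespan \<open>2 b + p\<close> would decide
  the size of a maximum induced bipartite subgraph of the conflict graph.
\<close>

definition overlap_interiorly :: "real \<times> real \<Rightarrow> real \<times> real \<Rightarrow> bool" where
  "overlap_interiorly A B \<longleftrightarrow>
     {fst A<..<snd A} \<inter> {fst B..snd B} \<noteq> {} \<or> {fst A..snd A} \<inter> {fst B<..<snd B} \<noteq> {}"

lemma overlap_interiorly_iff:
  assumes "a < b" and "c < d"
  shows "overlap_interiorly (a, b) (c, d) \<longleftrightarrow> {a<..<b} \<inter> {c<..<d} \<noteq> {}"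
proof
  assume "overlap_interiorly (a, b) (c, d)"
  then have "max a c < min b d"
    using assms by (auto simp: overlap_interiorly_def)
  then obtain x where "max a c < x" "x < min b d"
    using dense by blast
  then show "{a<..<b} \<inter> {c<..<d} \<noteq> {}"
    by auto
next
  assume "{a<..<b} \<inter> {c<..<d} \<noteq> {}"
  then show "overlap_interiorly (a, b) (c, d)"
    unfolding overlap_interiorly_def fst_conv snd_conv
    using greaterThanLessThan_subseteq_atLeastAtMost_iff[of c d c d] by blast
qed

definition blocking_intervals :: "smc_instance \<Rightarrow> schedule \<Rightarrow> nat \<Rightarrow> (real \<times> real) set" where
  "blocking_intervals I \<sigma> j =
     {(start \<sigma> j, start \<sigma> j + of_rat (first_block I j)),
      (completion I \<sigma> j - of_rat (second_block I j), completion I \<sigma> j)}"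

definition conflict_free :: "smc_instance \<Rightarrow> schedule \<Rightarrow> bool" where
  "conflict_free I \<sigma> \<longleftrightarrow>
     (\<forall>j\<in>jobs I. machine \<sigma> j \<in> machines I \<and> start \<sigma> j \<ge> 0) \<and>
     (\<forall>j\<in>jobs I. \<forall>k\<in>jobs I. j \<noteq> k \<and> machine \<sigma> j = machine \<sigma> k \<longrightarrow>
        {start \<sigma> j<..<completion I \<sigma> j} \<inter> {start \<sigma> k<..<completion I \<sigma> k} = {}) \<and>
     (\<forall>j\<in>jobs I. \<forall>k\<in>jobs I. {machine \<sigma> j, machine \<sigma> k} \<in> conflicts I \<longrightarrow>
        (\<forall>A\<in>blocking_intervals I \<sigma> j. \<forall>B\<in>blocking_intervals I \<sigma> k. \<not> overlap_interiorly A B))"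

text \<open>Inserting 0 only fixes the makespan when there are no jobs: completion times are nonnegative.\<close>

definition makespan :: "smc_instance \<Rightarrow> schedule \<Rightarrow> real" where
  "makespan I \<sigma> = Max (insert 0 (completion I \<sigma> ` jobs I))"

definition opt_makespan :: "smc_instance \<Rightarrow> real" where
  "opt_makespan I = Inf {makespan I \<sigma> | \<sigma>. conflict_free I \<sigma>}"

definition independent :: "smc_instance \<Rightarrow> nat set \<Rightarrow> bool" where
  "independent I S \<longleftrightarrow> S \<subseteq> machines I \<and> indep S (conflicts I)"

definition alpha1 :: "smc_instance \<Rightarrow> nat" where
  "alpha1 I = Max (card ` {S. independent I S})"

definition approx_max_independent :: "real \<Rightarrow> smc_instance \<Rightarrow> nat set \<Rightarrow> bool" where
  "approx_max_independent \<gamma> I S \<longleftrightarrow> independent I S \<and> real (card S) \<ge> real (alpha1 I) / \<gamma>"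

section \<open>Polynomial-time computation\<close>

text \<open>
  The model of computation is a random access machine on natural numbers with structured control
  flow and the logarithmic cost criterion. A program uses finitely many named arrays, all of
  unbounded length; a scalar variable is the entry 0 of an array. Evaluating an expression costs
  the binary length of every operand, address and result involved, so running time is polynomially
  related to that of Turing machines.
\<close>

type_synonym store = "string \<Rightarrow> nat \<Rightarrow> nat"

datatype exp =
    Num nat
  | Read string exp
  | Add exp exp
  | Sub exp exp
  | Mul exp exp
  | Div exp exp

datatype test = Less exp exp | Not test | And test test

datatype prog =
    Skip
  | Write string exp exp
  | Seq prog prog
  | If test prog prog
  | While test prog

fun val :: "exp \<Rightarrow> store \<Rightarrow> nat" where
  "val (Num k) s = k"
| "val (Read x e) s = s x (val e s)"
| "val (Add e f) s = val e s + val f s"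
| "val (Sub e f) s = val e s - val f s"
| "val (Mul e f) s = val e s * val f s"
| "val (Div e f) s = val e s div val f s"

definition nat_size :: "nat \<Rightarrow> nat" where
  "nat_size k = Suc (floorlog 2 k)"

fun exp_cost :: "exp \<Rightarrow> store \<Rightarrow> nat" where
  "exp_cost (Num k) s = nat_size k"
| "exp_cost (Read x e) s = exp_cost e s + nat_size (val (Read x e) s)"
| "exp_cost (Add e f) s = exp_cost e s + exp_cost f s + nat_size (val (Add e f) s)"
| "exp_cost (Sub e f) s = exp_cost e s + exp_cost f s + nat_size (val (Sub e f) s)"
| "exp_cost (Mul e f) s = exp_cost e s + exp_cost f s + nat_size (val (Mul e f) s)"
| "exp_cost (Div e f) s = exp_cost e s + exp_cost f s + nat_size (val (Div e f) s)"

fun holds :: "test \<Rightarrow> store \<Rightarrow> bool" where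
  "holds (Less e f) s \<longleftrightarrow> val e s < val f s"
| "holds (Not b) s \<longleftrightarrow> \<not> holds b s"
| "holds (And b c) s \<longleftrightarrow> holds b s \<and> holds c s"

fun test_cost :: "test \<Rightarrow> store \<Rightarrow> nat" where
  "test_cost (Less e f) s = Suc (exp_cost e s + exp_cost f s)"
| "test_cost (Not b) s = Suc (test_cost b s)"
| "test_cost (And b c) s = Suc (test_cost b s + test_cost c s)"

text \<open>\<open>exec c s t s'\<close>: started in store \<open>s\<close>, program \<open>c\<close> halts in store \<open>s'\<close> after time \<open>t\<close>.\<close>

inductive exec :: "prog \<Rightarrow> store \<Rightarrow> nat \<Rightarrow> store \<Rightarrow> bool" where
  Skip: "exec Skip s 1 s"
| Write: "exec (Write x e f) s (Suc (exp_cost e s + exp_cost f s))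
            (s(x := (s x)(val e s := val f s)))"
| Seq: "exec c s t s' \<Longrightarrow> exec d s' u s'' \<Longrightarrow> exec (Seq c d) s (Suc (t + u)) s''"
| IfTrue: "holds b s \<Longrightarrow> exec c s t s' \<Longrightarrow> exec (If b c d) s (Suc (test_cost b s + t)) s'"
| IfFalse: "\<not> holds b s \<Longrightarrow> exec d s t s' \<Longrightarrow> exec (If b c d) s (Suc (test_cost b s + t)) s'"
| WhileFalse: "\<not> holds b s \<Longrightarrow> exec (While b c) s (Suc (test_cost b s)) s"
| WhileTrue: "holds b s \<Longrightarrow> exec c s t s' \<Longrightarrow> exec (While b c) s' u s''
    \<Longrightarrow> exec (While b c) s (Suc (test_cost b s + t + u)) s''"

inductive_cases exec_SkipE: "exec Skip s t s'"
inductive_cases exec_WriteE: "exec (Write x e f) s t s'"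
inductive_cases exec_SeqE: "exec (Seq c d) s t s'"
inductive_cases exec_IfE: "exec (If b c d) s t s'"
inductive_cases exec_WhileE: "exec (While b c) s t s'"

lemma exec_deterministic: "exec c s t s' \<Longrightarrow> exec c s u s'' \<Longrightarrow> t = u \<and> s' = s''"
proof (induction arbitrary: u s'' rule: exec.induct)
  case (Skip s)
  then show ?case by (elim exec_SkipE) simp
next
  case (Write x e f s)
  then show ?case by (elim exec_WriteE) simp
next
  case (Seq c s t s' d v s1)
  from Seq.prems show ?case by (rule exec_SeqE) (use Seq.IH in blast)
next
  case (IfTrue b s c t s' d)
  from IfTrue.prems show ?case by (rule exec_IfE) (use IfTrue.IH IfTrue.hyps in blast)+
next
  case (IfFalse b s d t s' c)
  from IfFalse.prems show ?case by (rule exec_IfE) (use IfFalse.IH IfFalse.hyps in blast)+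
next
  case (WhileFalse b s c)
  from WhileFalse.prems show ?case by (rule exec_WhileE) (use WhileFalse.hyps in simp_all)
next
  case (WhileTrue b s c t s' v s1)
  from WhileTrue.prems show ?case
    by (rule exec_WhileE) (use WhileTrue.IH WhileTrue.hyps in blast)+
qed

text \<open>
  Input and output are lists of natural numbers, held in the arrays \<open>in\<close> and \<open>out\<close>
  with the length in entry 0 and the elements in the entries from 1 on.
\<close>

definition input_store :: "nat list \<Rightarrow> store" where
  "input_store xs = (\<lambda>_ _. 0)(''in'' := (\<lambda>k. if k \<le> length xs then (length xs # xs) ! k else 0))"

definition output_of :: "store \<Rightarrow> nat list" where
  "output_of s = map (s ''out'') [1..<Suc (s ''out'' 0)]"

definition list_size :: "nat list \<Rightarrow> nat" where
  "list_size xs = sum_list (map nat_size xs)"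

definition solves_in_polytime ::
    "('a \<Rightarrow> nat list) \<Rightarrow> 'a set \<Rightarrow> ('a \<Rightarrow> nat list \<Rightarrow> bool) \<Rightarrow> prog \<Rightarrow> bool" where
  "solves_in_polytime enc X R c \<longleftrightarrow>
     (\<exists>q :: nat poly. \<forall>x\<in>X. \<exists>t s.
        exec c (input_store (enc x)) t s \<and> t \<le> poly q (list_size (enc x)) \<and> R x (output_of s))"

section \<open>Approximation algorithms\<close>

text \<open>A nonnegative rational is encoded by the numerator and the denominator of its reduced fraction.\<close>

definition encode_rat :: "rat \<Rightarrow> nat list" where
  "encode_rat x = [nat (fst (quotient_of x)), nat (snd (quotient_of x))]"

text \<open>
  The encoding of an instance and a set of machines: the numbers of jobs and of machines, the rows
  of the adjacency matrix, the characteristic vector of the set, the parameters of the jobs.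
\<close>

definition encode :: "smc_instance \<times> nat set \<Rightarrow> nat list" where
  "encode = (\<lambda>(I, S).
     [num_jobs I, num_machines I]
     @ concat (map (\<lambda>u. map (\<lambda>v. of_bool ({u, v} \<in> conflicts I)) [0..<num_machines I])
                   [0..<num_machines I])
     @ map (\<lambda>v. of_bool (v \<in> S)) [0..<num_machines I]
     @ concat (map (\<lambda>j. encode_rat (first_block I j) @ encode_rat (proc I j)
                        @ encode_rat (second_block I j)) [0..<num_jobs I]))"

text \<open>
  An output lists, for each job, its machine and the numerator and denominator of its starting
  time; the fraction need not be reduced.
\<close>

definition decodes_to :: "smc_instance \<Rightarrow> nat list \<Rightarrow> schedule \<Rightarrow> bool" where
  "decodes_to I ys \<sigma> \<longleftrightarrow> length ys = 3 * num_jobs I \<and>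
     (\<forall>j\<in>jobs I. machine \<sigma> j = ys ! (3 * j) \<and> ys ! (3 * j + 2) > 0 \<and>
        start \<sigma> j = real (ys ! (3 * j + 1)) / real (ys ! (3 * j + 2)))"

text \<open>
  \<open>approximation \<gamma> P r c\<close>: given an instance with property \<open>P\<close> together with a
  \<open>1/\<gamma>\<close>-approximate maximum independent set, \<open>c\<close> is an approximation algorithm with ratio
  \<open>r I\<close>, which may depend on the instance \<open>I\<close>.
\<close>

definition approximation ::
    "real \<Rightarrow> (smc_instance \<Rightarrow> bool) \<Rightarrow> (smc_instance \<Rightarrow> real) \<Rightarrow> prog \<Rightarrow> bool" where
  "approximation \<gamma> P r c \<longleftrightarrow>
     solves_in_polytime encode {(I, S). smc I \<and> P I \<and> approx_max_independent \<gamma> I S}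
       (\<lambda>(I, S) ys. \<exists>\<sigma>. decodes_to I ys \<sigma> \<and> conflict_free I \<sigma> \<and>
          makespan I \<sigma> \<le> r I * opt_makespan I) c"

end

theory Submission
  imports "HOL-Analysis.Henstock_Kurzweil_Integration" Defs
begin

text \<open>
  Under each of the three properties, a job started while a job on a conflicting machine is in the
  system would need a blocking interval that fits into a processing interval, which is too short.
  So the machines in use at any time form an independent set and at most \<open>\<alpha>\<^sub>1\<close> jobs are in the
  system simultaneously: this bounds the optimum from below by \<open>\<lceil>n / \<alpha>\<^sub>1\<rceil> q\<close> for equal system times
  \<open>q\<close>, and by \<open>(\<Sum>j. q j) / \<alpha>\<^sub>1\<close> in general. On the other hand, no conflict can occur on the
  given independent set \<open>S\<close>, where one and the same algorithm, Graham's list scheduling, attains all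
  three ratios: when a job starts, every machine of \<open>S\<close> has been assigned at least as much work as
  the machine of this job. In the program, all times are multiplied by the product \<open>D\<close> of the
  denominators, so that loads are natural numbers of polynomial length.
\<close>

subsection \<open>Lower bounds on the makespan\<close>

lemma overlap_interiorlyI:
  assumes "a < d" "c < b" "a \<le> b" "c \<le> d" "a < b \<or> c < d"
  shows "overlap_interiorly (a, b) (c, d)"
proof -
  \<comment> \<open>The closed interval may be a single point. A common point is \<open>u\<close> if
    \<open>x < u\<close>, and otherwise any point between \<open>x\<close> and
    \<open>min y v\<close>.\<close>
  have *: "{x<..<y} \<inter> {u..v} \<noteq> {}" if "x < y" "x < v" "u < y" "u \<le> v" for x y u v :: real
  proof (cases "x < u")
    case False
    have "x < min y v"
      using that by simp
    then obtain z where "x < z" "z < min y v"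
      using dense by blast
    then show ?thesis using False by auto
  qed (use that in auto)
  show ?thesis
    using assms *[of a b d c] *[of c d b a] unfolding overlap_interiorly_def fst_conv snd_conv
    by (metis Int_commute)
qed

text \<open>The form in which each of the three properties enters the lower bounds; properties I and
  II contribute equal system times in addition.\<close>

definition exclusive :: "smc_instance \<Rightarrow> bool" where
  "exclusive I \<longleftrightarrow> (\<forall>\<sigma>. conflict_free I \<sigma> \<longrightarrow> (\<forall>j\<in>jobs I. \<forall>k\<in>jobs I.
     {machine \<sigma> j, machine \<sigma> k} \<in> conflicts I \<longrightarrow>
       {start \<sigma> j<..<completion I \<sigma> j} \<inter> {start \<sigma> k<..<completion I \<sigma> k} = {}))"

text \<open>Reduces exclusivity to linear arithmetic. By symmetry \<open>j\<close>, started at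
  \<open>s\<close>, is the job that starts first, and \<open>k\<close> starts at \<open>t\<close>
  before \<open>j\<close> completes; each implication in \<open>contr\<close> separates one pair of
  blocking intervals. The guards reflect that two intervals of length 0 never overlap
  interiorly.\<close>

lemma exclusiveI:
  fixes a p b :: "nat \<Rightarrow> real"
  assumes I: "smc I"
    and abp: "\<And>j. j \<in> jobs I \<Longrightarrow> a j = of_rat (first_block I j)"
      "\<And>j. j \<in> jobs I \<Longrightarrow> p j = of_rat (proc I j)"
      "\<And>j. j \<in> jobs I \<Longrightarrow> b j = of_rat (second_block I j)"
    and contr: "\<And>j k s t. \<lbrakk>j \<in> jobs I; k \<in> jobs I; s \<le> t; t < s + a j + p j + b j;
      0 < a j \<or> 0 < a k \<longrightarrow> s + a j \<le> t \<or> t + a k \<le> s;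
      0 < a j \<or> 0 < b k \<longrightarrow> s + a j \<le> t + a k + p k \<or> t + a k + p k + b k \<le> s;
      0 < b j \<or> 0 < a k \<longrightarrow> s + a j + p j + b j \<le> t \<or> t + a k \<le> s + a j + p j;
      0 < b j \<or> 0 < b k \<longrightarrow>
        s + a j + p j + b j \<le> t + a k + p k \<or> t + a k + p k + b k \<le> s + a j + p j\<rbrakk> \<Longrightarrow> False"
  shows "exclusive I"
proof -
  have compl: "completion I \<sigma> j = start \<sigma> j + a j + p j + b j" if "j \<in> jobs I" for \<sigma> j
    using that by (simp add: completion_def system_time_def of_rat_add abp)
  have blocks: "blocking_intervals I \<sigma> j = {(start \<sigma> j, start \<sigma> j + a j),
      (start \<sigma> j + a j + p j, start \<sigma> j + a j + p j + b j)}" if "j \<in> jobs I" for \<sigma> j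
    using that compl[OF that, of \<sigma>] by (simp add: blocking_intervals_def abp)
  have nonneg: "a j \<ge> 0" "p j \<ge> 0" "b j \<ge> 0" if "j \<in> jobs I" for j
    using that I by (auto simp: smc_def abp)
  have before: False if \<sigma>: "conflict_free I \<sigma>" and jk: "j \<in> jobs I" "k \<in> jobs I"
      and "{machine \<sigma> j, machine \<sigma> k} \<in> conflicts I"
      and "start \<sigma> j \<le> start \<sigma> k" and "start \<sigma> k < completion I \<sigma> j" for \<sigma> j k
  proof -
    have no: "\<not> overlap_interiorly A B"
      if "A \<in> blocking_intervals I \<sigma> j" "B \<in> blocking_intervals I \<sigma> k" for A B
      using \<sigma> jk \<open>{machine \<sigma> j, machine \<sigma> k} \<in> conflicts I\<close> that by (simp add: conflict_free_def)
    have sep: "x < y \<or> u < v \<longrightarrow> y \<le> u \<or> v \<le> x" if "x \<le> y" "u \<le> v"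
      "(x, y) \<in> blocking_intervals I \<sigma> j" "(u, v) \<in> blocking_intervals I \<sigma> k" for x y u v
      using no[OF that(3,4)] overlap_interiorlyI[of x v u y] that(1,2) by linarith
    show False
      using nonneg[OF jk(1)] nonneg[OF jk(2)] that compl[OF jk(1), of \<sigma>]
        sep[of "start \<sigma> j" "start \<sigma> j + a j" "start \<sigma> k" "start \<sigma> k + a k"]
        sep[of "start \<sigma> j" "start \<sigma> j + a j"
            "start \<sigma> k + a k + p k" "start \<sigma> k + a k + p k + b k"]
        sep[of "start \<sigma> j + a j + p j" "start \<sigma> j + a j + p j + b j"
            "start \<sigma> k" "start \<sigma> k + a k"]
        sep[of "start \<sigma> j + a j + p j" "start \<sigma> j + a j + p j + b j"
            "start \<sigma> k + a k + p k" "start \<sigma> k + a k + p k + b k"]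
      by (intro contr[OF jk, of "start \<sigma> j" "start \<sigma> k"]) (simp_all add: blocks jk)
  qed
  show ?thesis
    unfolding exclusive_def
  proof (intro allI impI ballI, rule ccontr)
    fix \<sigma> j k
    assume \<sigma>: "conflict_free I \<sigma>" "j \<in> jobs I" "k \<in> jobs I"
      "{machine \<sigma> j, machine \<sigma> k} \<in> conflicts I"
    assume "{start \<sigma> j<..<completion I \<sigma> j} \<inter> {start \<sigma> k<..<completion I \<sigma> k} \<noteq> {}"
    then have "start \<sigma> j < completion I \<sigma> k" "start \<sigma> k < completion I \<sigma> j"
      by auto
    moreover have "{machine \<sigma> k, machine \<sigma> j} \<in> conflicts I"
      using \<sigma>(4) by (simp add: insert_commute)
    ultimately show False
      using before[OF \<sigma>] before[OF \<sigma>(1,3,2)] by (meson linear)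
  qed
qed

text \<open>For identical jobs, a pair of corresponding blocks longer than \<open>p\<close> keeps
  the two starts more than \<open>p\<close> apart. But the first block of the later job must end
  before the second block of the earlier one begins, so the starts differ by at most
  \<open>p\<close>.\<close>

lemma prop_I_exclusive:
  assumes "smc I" "prop_I I"
  shows "exclusive I"
proof (cases "jobs I = {}")
  case False
  obtain b p b' where *: "max b b' > p"
    "\<forall>j\<in>jobs I. first_block I j = b \<and> proc I j = p \<and> second_block I j = b'"
    using assms(2) by (auto simp: prop_I_def)
  then have "p \<ge> 0" "b \<ge> 0" "b' \<ge> 0"
    using assms(1) False by (auto simp: smc_def)
  then have bp: "(of_rat p :: real) \<ge> 0" "(of_rat b :: real) \<ge> 0" "(of_rat b' :: real) \<ge> 0"
    by simp_all
  have max: "(of_rat b :: real) > of_rat p \<or> (of_rat b' :: real) > of_rat p"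
    using * by (auto simp: of_rat_less)
  show ?thesis
  proof (rule exclusiveI[OF assms(1), of "\<lambda>_. of_rat b" "\<lambda>_. of_rat p" "\<lambda>_. of_rat b'"],
      goal_cases)
    case (4 j k s t)
    show ?case
      using max
    proof
      assume "(of_rat b :: real) > of_rat p"
      then show ?thesis
        using 4(3-) bp by linarith
    next
      assume "(of_rat b' :: real) > of_rat p"
      then show ?thesis
        using 4(3-) bp by linarith
    qed
  qed (use * in auto)
qed (simp add: exclusive_def)

text \<open>With equal system times the later job also completes no earlier. So the first block of
  \<open>k\<close> fits into the processing interval of \<open>j\<close>, and the second block of
  \<open>j\<close> into that of \<open>k\<close>. This closes a cycle: first block of
  \<open>k\<close> \<le> processing time of \<open>j\<close> < second block of \<open>j\<close>
  \<le> processing time of \<open>k\<close> < first block of \<open>k\<close>.\<close>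

lemma prop_II_exclusive:
  assumes "smc I" "prop_II I"
  shows "exclusive I"
proof (rule exclusiveI[OF assms(1) refl refl refl], goal_cases)
  case (1 j k s t)
  have "system_time I j = system_time I k"
    using assms(2) 1(1,2) by (auto simp: prop_II_def)
  then have "(of_rat (first_block I j) :: real) + of_rat (proc I j) + of_rat (second_block I j)
      = of_rat (first_block I k) + of_rat (proc I k) + of_rat (second_block I k)"
    unfolding system_time_def by (simp flip: of_rat_add)
  moreover have "(of_rat (proc I i) :: real) \<ge> 0"
    "(of_rat (first_block I i) :: real) > of_rat (proc I i)"
    "(of_rat (second_block I i) :: real) > of_rat (proc I i)" if "i \<in> jobs I" for i
    using assms that by (auto simp: prop_II_def smc_def of_rat_less)
  note this[OF 1(1)] this[OF 1(2)]
  ultimately show ?case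
    using 1(3-) by argo
qed

text \<open>The first block of \<open>k\<close> comes after that of \<open>j\<close> and must end
  before the second block of \<open>j\<close> begins, so it would fit into the shorter processing
  interval of \<open>j\<close>.\<close>

lemma prop_III_exclusive:
  assumes "smc I" "prop_III I"
  shows "exclusive I"
proof (rule exclusiveI[OF assms(1) refl refl refl], goal_cases)
  case (1 j k s t)
  have "(of_rat (proc I i) :: real) \<ge> 0"
    "(of_rat (first_block I i) :: real) > of_rat (proc I l)"
    "(of_rat (second_block I i) :: real) > of_rat (proc I l)" if "i \<in> jobs I" "l \<in> jobs I" for i l
    using assms that by (auto simp: prop_III_def smc_def of_rat_less)
  note this[OF 1(1,1)] this[OF 1(1,2)] this[OF 1(2,1)] this[OF 1(2,2)]
  then show ?case
    using 1(3-) by argo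
qed

section \<open>Counting the jobs in the system by independent sets\<close>

lemma finite_independent: "finite {S. independent I S}"
  by (rule finite_subset[of _ "Pow (machines I)"]) (auto simp: independent_def machines_def)

lemma card_le_alpha1: "independent I S \<Longrightarrow> card S \<le> alpha1 I"
  unfolding alpha1_def using finite_independent by (intro Max_ge) auto

lemma alpha1_pos: "smc I \<Longrightarrow> alpha1 I \<ge> 1"
  using card_le_alpha1[of I "{0}"] by (auto simp: independent_def indep_def smc_def machines_def)

text \<open>The jobs counted share the point \<open>t\<close>, so their machines are pairwise
  distinct and not in conflict: \<open>machine \<sigma>\<close> maps them injectively onto an
  independent set.\<close>

lemma card_active_le:
  assumes "conflict_free I \<sigma>" "exclusive I"
  shows "card {j \<in> jobs I. start \<sigma> j < t \<and> t < completion I \<sigma> j} \<le> alpha1 I" (is "card ?A \<le> _")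
proof -
  have "inj_on (machine \<sigma>) ?A"
  proof (rule inj_onI, rule ccontr)
    fix j k
    assume jk: "j \<in> ?A" "k \<in> ?A" "machine \<sigma> j = machine \<sigma> k" "j \<noteq> k"
    then have "{start \<sigma> j<..<completion I \<sigma> j} \<inter> {start \<sigma> k<..<completion I \<sigma> k} = {}"
      using assms(1) by (simp add: conflict_free_def)
    with jk show False by auto
  qed
  then have "card ?A = card (machine \<sigma> ` ?A)"
    by (simp add: card_image)
  moreover have "independent I (machine \<sigma> ` ?A)"
    unfolding independent_def
  proof
    show "machine \<sigma> ` ?A \<subseteq> machines I"
      using assms(1) by (auto simp: conflict_free_def)
    have "{machine \<sigma> j, machine \<sigma> k} \<notin> conflicts I" if "j \<in> ?A" "k \<in> ?A" for j k
    proof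
      assume "{machine \<sigma> j, machine \<sigma> k} \<in> conflicts I"
      then have "{start \<sigma> j<..<completion I \<sigma> j} \<inter> {start \<sigma> k<..<completion I \<sigma> k} = {}"
        using assms that by (simp add: exclusive_def)
      with that show False by auto
    qed
    then show "indep (machine \<sigma> ` ?A) (conflicts I)"
      by (auto simp: indep_def)
  qed
  ultimately show ?thesis
    using card_le_alpha1[of I "machine \<sigma> ` ?A"] by linarith
qed

lemma finite_jobs [simp]: "finite (jobs I)"
  by (simp add: jobs_def)

lemma completion_le_makespan: "j \<in> jobs I \<Longrightarrow> completion I \<sigma> j \<le> makespan I \<sigma>"
  unfolding makespan_def by (intro Max_ge) auto

lemma makespan_nonneg: "makespan I \<sigma> \<ge> 0"
  unfolding makespan_def by (intro Max_ge) auto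

lemma system_time_nonneg: "smc I \<Longrightarrow> j \<in> jobs I \<Longrightarrow> system_time I j \<ge> 0"
  by (simp add: smc_def system_time_def)

text \<open>Area argument: the number of jobs in the system at time \<open>x\<close>, integrated
  over the time from 0 to the makespan, gives the total system time, and the integrand is at most
  \<alpha>\<open>\<^sub>1\<close>.\<close>

lemma sum_system_time_le:
  assumes "smc I" "conflict_free I \<sigma>" "exclusive I"
  shows "(\<Sum>j\<in>jobs I. of_rat (system_time I j)) \<le> alpha1 I * makespan I \<sigma>"
proof -
  let ?X = "\<lambda>j. {start \<sigma> j<..<completion I \<sigma> j}"
  have *: "((\<lambda>x. if x \<in> ?X j then 1 else (0::real)) has_integral of_rat (system_time I j)) {0..makespan I \<sigma>}"
    if j: "j \<in> jobs I" for j
  proof -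
    have "start \<sigma> j \<ge> 0" "completion I \<sigma> j \<le> makespan I \<sigma>"
      using j assms(2) completion_le_makespan by (auto simp: conflict_free_def)
    then have sub: "?X j \<subseteq> {0..makespan I \<sigma>}" by auto
    have "start \<sigma> j \<le> completion I \<sigma> j"
      using system_time_nonneg[OF assms(1) j] by (simp add: completion_def)
    then have "((\<lambda>x. 1::real) has_integral of_rat (system_time I j)) {start \<sigma> j..completion I \<sigma> j}"
      using has_integral_const_real[of "1::real" "start \<sigma> j" "completion I \<sigma> j"]
      by (simp add: completion_def)
    \<comment> \<open>Dropping the endpoints leaves the integral unchanged and matches the strict
      inequalities in \<open>card_active_le\<close>.\<close>
    then have "((\<lambda>x. 1::real) has_integral of_rat (system_time I j)) (?X j)"
      by (simp add: has_integral_Icc_iff_Ioo)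
    then show ?thesis
      by (simp only: has_integral_restrict[OF sub])
  qed
  have "((\<lambda>x. \<Sum>j\<in>jobs I. if x \<in> ?X j then 1 else (0::real)) has_integral
      (\<Sum>j\<in>jobs I. of_rat (system_time I j))) {0..makespan I \<sigma>}"
    using * by (intro has_integral_sum) auto
  moreover have "((\<lambda>x. real (alpha1 I)) has_integral makespan I \<sigma> * alpha1 I) {0..makespan I \<sigma>}"
    using has_integral_const_real[of "real (alpha1 I)" 0 "makespan I \<sigma>"] makespan_nonneg[of I \<sigma>] by simp
  moreover have "(\<Sum>j\<in>jobs I. if x \<in> ?X j then 1 else (0::real)) \<le> alpha1 I" for x
    using card_active_le[OF assms(2,3), of x]
    by (simp add: sum.If_cases Int_def)
  ultimately show ?thesis
    using has_integral_le by (metis (no_types, lifting) mult.commute)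
qed

text \<open>
  If the makespan \<open>M\<close> were less than \<open>Suc k * q\<close>, then each of the \<open>n\<close> occupied intervals would
  contain one of the \<open>k\<close> inner points of the partition of \<open>[0, M]\<close> into \<open>Suc k\<close> equal parts.
\<close>

lemma makespan_ge_mult:
  assumes \<sigma>: "conflict_free I \<sigma>" and ex: "exclusive I"
    and q: "\<And>j. j \<in> jobs I \<Longrightarrow> of_rat (system_time I j) = q"
    and k: "k * alpha1 I < num_jobs I"
  shows "makespan I \<sigma> \<ge> real (Suc k) * q"
proof (rule ccontr)
  assume "\<not> ?thesis"
  define \<delta> where "\<delta> = makespan I \<sigma> / real (Suc k)"
  have M: "makespan I \<sigma> = real (Suc k) * \<delta>"
    by (simp add: \<delta>_def)
  with \<open>\<not> ?thesis\<close> have "\<delta> < q"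
    by (simp add: not_le mult_less_cancel_left del: of_nat_Suc)
  have "\<delta> \<ge> 0"
    using makespan_nonneg by (simp add: \<delta>_def)
  let ?A = "\<lambda>i. {j \<in> jobs I. start \<sigma> j < real i * \<delta> \<and> real i * \<delta> < completion I \<sigma> j}"
  have "jobs I \<subseteq> (\<Union>i\<in>{1..k}. ?A i)"
  proof
    fix j assume j: "j \<in> jobs I"
    have s: "start \<sigma> j \<ge> 0" "start \<sigma> j + q \<le> real (Suc k) * \<delta>"
      using j \<sigma> completion_le_makespan[OF j, of \<sigma>] q[OF j] M by (auto simp: conflict_free_def completion_def)
    then have "\<delta> > 0"
      using \<open>\<delta> < q\<close> \<open>\<delta> \<ge> 0\<close> by (cases "\<delta> = 0") auto
    \<comment> \<open>\<open>i * \<delta>\<close> is the first multiple of \<open>\<delta>\<close>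
      strictly after the start of \<open>j\<close>; since \<open>\<delta> < q\<close>, it comes
      before the completion of \<open>j\<close>.\<close>
    define i where "i = Suc (nat \<lfloor>start \<sigma> j / \<delta>\<rfloor>)"
    have "real i = of_int \<lfloor>start \<sigma> j / \<delta>\<rfloor> + 1"
      using s(1) \<open>\<delta> > 0\<close> by (simp add: i_def)
    then have "start \<sigma> j / \<delta> < real i" "real i \<le> start \<sigma> j / \<delta> + 1"
      by linarith+
    then have i: "start \<sigma> j < real i * \<delta>" "real i * \<delta> \<le> start \<sigma> j + \<delta>"
      using \<open>\<delta> > 0\<close> by (simp_all add: field_simps)
    with s \<open>\<delta> < q\<close> have "real i * \<delta> < real (Suc k) * \<delta>"
      by linarith
    then have "i \<le> k"
      using \<open>\<delta> > 0\<close> by (simp add: mult_less_cancel_right del: of_nat_Suc)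
    moreover have "i \<ge> 1" by (simp add: i_def)
    moreover have "j \<in> ?A i"
      using j i \<open>\<delta> < q\<close> q[OF j] by (simp add: completion_def)
    ultimately show "j \<in> (\<Union>i\<in>{1..k}. ?A i)" by auto
  qed
  then have "card (jobs I) \<le> card (\<Union>i\<in>{1..k}. ?A i)"
    by (intro card_mono) auto
  also have "\<dots> \<le> (\<Sum>i\<in>{1..k}. card (?A i))"
    by (rule card_UN_le) simp
  also have "\<dots> \<le> (\<Sum>i\<in>{1..k}. alpha1 I)"
    by (intro sum_mono card_active_le[OF \<sigma> ex])
  finally show False
    using k by (simp add: jobs_def)
qed

subsection \<open>Cost bounds for programs\<close>

lemma nat_size_le_iff: "nat_size k \<le> Suc w \<longleftrightarrow> k < 2 ^ w"
  by (simp add: nat_size_def floorlog_le_iff)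

lemma less_power_nat_size: "k < 2 ^ nat_size k"
  unfolding nat_size_def by (rule floorlog_leD) auto

lemma nat_size_pos [simp]: "Suc 0 \<le> nat_size k"
  by (simp add: nat_size_def)

lemma nat_size_mono: "a \<le> b \<Longrightarrow> nat_size a \<le> nat_size b"
  by (simp add: nat_size_def floorlog_mono)

lemma nat_size_mult: "nat_size (a * b) \<le> nat_size a + nat_size b"
proof -
  obtain x y where xy: "nat_size a = Suc x" "nat_size b = Suc y"
    by (simp add: nat_size_def)
  then have "a < 2 ^ x" "b < 2 ^ y"
    using nat_size_le_iff by (metis order_refl)+
  then have "a * b < 2 ^ x * 2 ^ y"
    by (intro mult_strict_mono) auto
  then have "nat_size (a * b) \<le> Suc (x + y)"
    by (simp add: nat_size_le_iff power_add)
  then show ?thesis using xy by simp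
qed

lemma nat_size_add: "nat_size (a + b) \<le> nat_size a + nat_size b"
proof -
  obtain x y where xy: "nat_size a = Suc x" "nat_size b = Suc y"
    by (simp add: nat_size_def)
  then have "a < 2 ^ x" "b < 2 ^ y"
    using nat_size_le_iff by (metis order_refl)+
  moreover have "(2::nat) ^ x \<le> 2 ^ (x + y)" "(2::nat) ^ y \<le> 2 ^ (x + y)"
    by (intro power_increasing; simp)+
  ultimately have "a + b < 2 ^ Suc (x + y)"
    unfolding power_Suc by linarith
  then have "nat_size (a + b) \<le> Suc (Suc (x + y))"
    by (simp only: nat_size_le_iff)
  then show ?thesis using xy by simp
qed

text \<open>One bit bound for the whole memory separates cost from contents: every step then costs
  at most \<open>Suc w\<close> times a number read off the program text.\<close>

definition bounded_store :: "nat \<Rightarrow> store \<Rightarrow> bool" where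
  "bounded_store w s \<longleftrightarrow> (\<forall>x k. s x k < 2 ^ w)"

text \<open>Measures the binary length of the value in units of \<open>Suc w\<close>. The cost,
  which adds the lengths of all intermediate values, is bounded by the square of the weight.\<close>

fun exp_weight :: "exp \<Rightarrow> nat" where
  "exp_weight (Num k) = nat_size k"
| "exp_weight (Read x e) = Suc (exp_weight e)"
| "exp_weight (Add e f) = exp_weight e + exp_weight f"
| "exp_weight (Sub e f) = exp_weight e + exp_weight f"
| "exp_weight (Mul e f) = exp_weight e + exp_weight f"
| "exp_weight (Div e f) = exp_weight e + exp_weight f"

fun test_weight :: "test \<Rightarrow> nat" where
  "test_weight (Less e f) = Suc ((exp_weight e)\<^sup>2 + (exp_weight f)\<^sup>2)"
| "test_weight (Not b) = Suc (test_weight b)"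
| "test_weight (And b c) = Suc (test_weight b + test_weight c)"

text \<open>
  If every loop of a program performs at most \<open>m\<close> iterations and all entries of the arrays
  stay below \<open>2 ^ w\<close>, then \<open>Suc w * prog_weight m c\<close> bounds the running time.
\<close>

fun prog_weight :: "nat \<Rightarrow> prog \<Rightarrow> nat" where
  "prog_weight m Skip = 1"
| "prog_weight m (Write x e f) = Suc ((exp_weight e)\<^sup>2 + (exp_weight f)\<^sup>2)"
| "prog_weight m (Seq c d) = Suc (prog_weight m c + prog_weight m d)"
| "prog_weight m (If b c d) = Suc (test_weight b + prog_weight m c + prog_weight m d)"
| "prog_weight m (While b c) = Suc (test_weight b) + m * Suc (test_weight b + prog_weight m c)"

lemma exp_weight_pos [simp]: "Suc 0 \<le> exp_weight e"
  by (induction e) (auto intro: trans_le_add1)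

lemma nat_size_val:
  assumes "bounded_store w s"
  shows "nat_size (val e s) \<le> Suc w * exp_weight e"
proof (induction e)
  case (Num k)
  then show ?case by simp
next
  case (Read x e)
  have "s x (val e s) < 2 ^ w"
    using assms by (simp add: bounded_store_def)
  then have "nat_size (s x (val e s)) \<le> Suc w"
    by (simp only: nat_size_le_iff)
  then show ?case by simp
next
  case (Add e f)
  then show ?case
    using nat_size_add[of "val e s" "val f s"] by (simp add: algebra_simps)
next
  case (Sub e f)
  then show ?case
    using nat_size_mono[of "val e s - val f s" "val e s"] by (simp add: algebra_simps)
next
  case (Mul e f)
  then show ?case
    using nat_size_mult[of "val e s" "val f s"] by (simp add: algebra_simps)
next
  case (Div e f)
  then show ?case
    using nat_size_mono[of "val e s div val f s" "val e s"] by (simp add: algebra_simps)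
qed

text \<open>Induction step for \<open>exp_cost_le\<close>: the cross term \<open>2 * a * b\<close>
  of the square is at least \<open>a + b\<close> and pays for the length of the result.\<close>

lemma square_sum_bound:
  fixes a b :: nat
  assumes "Suc 0 \<le> a" "Suc 0 \<le> b" "x \<le> w * a\<^sup>2" "y \<le> w * b\<^sup>2" "z \<le> w * (a + b)"
  shows "x + y + z \<le> w * (a + b)\<^sup>2"
proof -
  have "1 * a \<le> b * a" "1 * b \<le> a * b"
    using assms by (intro mult_right_mono; simp)+
  then have "a + b \<le> 2 * a * b"
    unfolding mult.commute[of b a] by linarith
  then have "a\<^sup>2 + b\<^sup>2 + (a + b) \<le> (a + b)\<^sup>2"
    by (simp add: power2_eq_square algebra_simps)
  then have "w * (a\<^sup>2 + b\<^sup>2 + (a + b)) \<le> w * (a + b)\<^sup>2"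
    by (intro mult_left_mono) auto
  then show ?thesis
    using assms by (simp add: algebra_simps)
qed

lemma exp_cost_le:
  assumes "bounded_store w s"
  shows "exp_cost e s \<le> Suc w * (exp_weight e)\<^sup>2"
proof (induction e)
  case (Num k)
  have "nat_size k * 1 \<le> nat_size k * nat_size k"
    by (intro mult_left_mono) auto
  then show ?case by (simp add: power2_eq_square trans_le_add1)
next
  case (Read x e)
  have "s x (val e s) < 2 ^ w"
    using assms by (simp add: bounded_store_def)
  then have "nat_size (s x (val e s)) \<le> Suc w"
    by (simp only: nat_size_le_iff)
  then show ?case using Read by (simp add: power2_eq_square algebra_simps)
next
  case (Add e f)
  show ?case unfolding exp_cost.simps exp_weight.simps
    by (rule square_sum_bound) (use Add nat_size_val[OF assms, of "Add e f"] in auto)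
next
  case (Sub e f)
  show ?case unfolding exp_cost.simps exp_weight.simps
    by (rule square_sum_bound) (use Sub nat_size_val[OF assms, of "Sub e f"] in auto)
next
  case (Mul e f)
  show ?case unfolding exp_cost.simps exp_weight.simps
    by (rule square_sum_bound) (use Mul nat_size_val[OF assms, of "Mul e f"] in auto)
next
  case (Div e f)
  show ?case unfolding exp_cost.simps exp_weight.simps
    by (rule square_sum_bound) (use Div nat_size_val[OF assms, of "Div e f"] in auto)
qed

lemma test_cost_le:
  assumes "bounded_store w s"
  shows "test_cost b s \<le> Suc w * test_weight b"
proof (induction b)
  case (Less e f)
  then show ?case
    using exp_cost_le[OF assms, of e] exp_cost_le[OF assms, of f] by (simp add: algebra_simps)
qed (auto simp: algebra_simps)

text \<open>Each level of loop nesting contributes one factor \<open>m\<close>, and the program is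
  fixed while \<open>m\<close> varies.\<close>

lemma prog_weight_poly: "\<exists>q :: nat poly. \<forall>m. prog_weight m c = poly q m"
proof (induction c)
  case (Seq c d)
  then obtain p q where "\<And>m. prog_weight m c = poly p m" "\<And>m. prog_weight m d = poly q m"
    by blast
  then have "\<forall>m. prog_weight m (Seq c d) = poly ([:1:] + p + q) m"
    by simp
  then show ?case ..
next
  case (If b c d)
  then obtain p q where "\<And>m. prog_weight m c = poly p m" "\<And>m. prog_weight m d = poly q m"
    by blast
  then have "\<forall>m. prog_weight m (If b c d) = poly ([:Suc (test_weight b):] + p + q) m"
    by simp
  then show ?case ..
next
  case (While b c)
  then obtain p where "\<And>m. prog_weight m c = poly p m"
    by blast
  then have "\<forall>m. prog_weight m (While b c) =
      poly ([:Suc (test_weight b):] + [:0, 1:] * ([:Suc (test_weight b):] + p)) m"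
    by simp
  then show ?case ..
qed (rule exI[of _ "[:_:]"], simp)+

text \<open>Total correctness together with a time bound. The bit bound \<open>w\<close> is part of
  the postcondition, so that the time bounds of consecutive commands compose.\<close>

definition triple :: "nat \<Rightarrow> nat \<Rightarrow> (store \<Rightarrow> bool) \<Rightarrow> prog \<Rightarrow> (store \<Rightarrow> bool) \<Rightarrow> bool" where
  "triple w m P c Q \<longleftrightarrow>
     (\<forall>s. bounded_store w s \<longrightarrow> P s \<longrightarrow>
        (\<exists>t s'. exec c s t s' \<and> t \<le> Suc w * prog_weight m c \<and> bounded_store w s' \<and> Q s'))"

lemma tripleE:
  assumes "triple w m P c Q" "bounded_store w s" "P s"
  obtains t s' where "exec c s t s'" "t \<le> Suc w * prog_weight m c" "bounded_store w s'" "Q s'"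
  using assms unfolding triple_def by blast

lemma triple_conseq:
  assumes "triple w m P c Q"
    and "\<And>s. bounded_store w s \<Longrightarrow> P' s \<Longrightarrow> P s"
    and "\<And>s. bounded_store w s \<Longrightarrow> Q s \<Longrightarrow> Q' s"
  shows "triple w m P' c Q'"
  using assms unfolding triple_def by blast

lemma triple_Skip: "triple w m P Skip P"
  unfolding triple_def using exec.Skip by fastforce

text \<open>The one rule with an obligation on the size of a value; all others pass the bit bound
  on.\<close>

lemma triple_Write:
  assumes "\<And>s. bounded_store w s \<Longrightarrow> P s \<Longrightarrow>
    val f s < 2 ^ w \<and> Q (s(x := (s x)(val e s := val f s)))"
  shows "triple w m P (Write x e f) Q"
  unfolding triple_def
proof (intro allI impI)
  fix s assume s: "bounded_store w s" "P s"
  let ?s = "s(x := (s x)(val e s := val f s))"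
  have "exec (Write x e f) s (Suc (exp_cost e s + exp_cost f s)) ?s"
    by (rule exec.Write)
  moreover have "Suc (exp_cost e s + exp_cost f s) \<le> Suc w * prog_weight m (Write x e f)"
    using exp_cost_le[OF s(1), of e] exp_cost_le[OF s(1), of f] by (simp add: algebra_simps)
  moreover have "bounded_store w ?s"
    using s assms by (auto simp: bounded_store_def)
  ultimately show "\<exists>t s'. exec (Write x e f) s t s' \<and> t \<le> Suc w * prog_weight m (Write x e f)
      \<and> bounded_store w s' \<and> Q s'"
    using assms s by blast
qed

lemma triple_Seq:
  assumes "triple w m P c R" "triple w m R d Q"
  shows "triple w m P (Seq c d) Q"
  unfolding triple_def
proof (intro allI impI)
  fix s assume s: "bounded_store w s" "P s"
  obtain t s' where c: "exec c s t s'" "t \<le> Suc w * prog_weight m c" "bounded_store w s'" "R s'"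
    using assms(1) s unfolding triple_def by blast
  obtain u s'' where d: "exec d s' u s''" "u \<le> Suc w * prog_weight m d" "bounded_store w s''" "Q s''"
    using assms(2) c(3,4) unfolding triple_def by blast
  have "Suc (t + u) \<le> Suc w * prog_weight m (Seq c d)"
    using c(2) d(2) by (simp add: algebra_simps)
  with exec.Seq[OF c(1) d(1)] d(3,4)
  show "\<exists>t s'. exec (Seq c d) s t s' \<and> t \<le> Suc w * prog_weight m (Seq c d)
      \<and> bounded_store w s' \<and> Q s'"
    by blast
qed

lemma triple_If:
  assumes c: "triple w m (\<lambda>s. P s \<and> holds b s) c Q"
    and d: "triple w m (\<lambda>s. P s \<and> \<not> holds b s) d Q"
  shows "triple w m P (If b c d) Q"
  unfolding triple_def
proof (intro allI impI)
  fix s assume s: "bounded_store w s" "P s"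
  note b = test_cost_le[OF s(1), of b]
  show "\<exists>t s'. exec (If b c d) s t s' \<and> t \<le> Suc w * prog_weight m (If b c d)
      \<and> bounded_store w s' \<and> Q s'"
  proof (cases "holds b s")
    case True
    obtain t s' where t: "exec c s t s'" "t \<le> Suc w * prog_weight m c" "bounded_store w s'" "Q s'"
      using tripleE[OF c s(1)] s(2) True by blast
    have "Suc (test_cost b s + t) \<le> Suc w * prog_weight m (If b c d)"
      using b t(2) by (simp add: algebra_simps)
    then show ?thesis
      using exec.IfTrue[OF True t(1)] t(3,4) by blast
  next
    case False
    obtain t s' where t: "exec d s t s'" "t \<le> Suc w * prog_weight m d" "bounded_store w s'" "Q s'"
      using tripleE[OF d s(1)] s(2) False by blast
    have "Suc (test_cost b s + t) \<le> Suc w * prog_weight m (If b c d)"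
      using b t(2) by (simp add: algebra_simps)
    then show ?thesis
      using exec.IfFalse[OF False t(1)] t(3,4) by blast
  qed
qed

text \<open>The invariant is indexed by the number of completed iterations, so a test equivalent to
  \<open>k < n\<close> fixes the iteration count at exactly \<open>n\<close>.\<close>

lemma triple_While:
  assumes test: "\<And>k s. bounded_store w s \<Longrightarrow> I k s \<Longrightarrow> k \<le> n \<Longrightarrow> holds b s \<longleftrightarrow> k < n"
    and body: "\<And>k. k < n \<Longrightarrow> triple w m (I k) c (I (Suc k))"
    and "n \<le> m"
  shows "triple w m (I 0) (While b c) (I n)"
proof -
  let ?r = "Suc (test_weight b + prog_weight m c)"
  \<comment> \<open>The budget covers the \<open>n - k\<close> iterations still to come and the
    final failing test.\<close>
  have run: "\<exists>t s'. exec (While b c) s t s' \<and>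
      t \<le> Suc w * (Suc (test_weight b) + (n - k) * ?r) \<and> bounded_store w s' \<and> I n s'"
    if "k \<le> n" "bounded_store w s" "I k s" for k s
    using that
  proof (induction "n - k" arbitrary: k s)
    case 0
    then have "k = n" by simp
    with 0 test have "\<not> holds b s" by blast
    note exec.WhileFalse[OF this, of c]
    moreover have "Suc (test_cost b s) \<le> Suc w * (Suc (test_weight b) + (n - k) * ?r)"
      using test_cost_le[OF \<open>bounded_store w s\<close>, of b] by (simp add: algebra_simps)
    ultimately show ?case
      using 0 \<open>k = n\<close> by blast
  next
    case (Suc i)
    then have "k < n" by simp
    with Suc test have b: "holds b s" by auto
    obtain t s' where t: "exec c s t s'" "t \<le> Suc w * prog_weight m c" "bounded_store w s'"
        "I (Suc k) s'"
      using body[OF \<open>k < n\<close>] Suc.prems(2,3) unfolding triple_def by blast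
    have "i = n - Suc k" "Suc k \<le> n"
      using Suc.hyps(2) by simp_all
    with Suc.hyps(1)[OF _ _ t(3,4)] obtain u s'' where u: "exec (While b c) s' u s''"
        "u \<le> Suc w * (Suc (test_weight b) + (n - Suc k) * ?r)" "bounded_store w s''" "I n s''"
      by blast
    have "n - k = Suc (n - Suc k)"
      using \<open>k < n\<close> by simp
    then have "Suc w * (Suc (test_weight b) + (n - k) * ?r)
        = Suc w * ?r + Suc w * (Suc (test_weight b) + (n - Suc k) * ?r)"
      by (simp only: mult_Suc distrib_left add.commute add.left_commute)
    moreover have "Suc (test_cost b s + t) \<le> Suc w * ?r"
      using t(2) test_cost_le[OF \<open>bounded_store w s\<close>, of b] by (simp add: algebra_simps)
    ultimately have "Suc (test_cost b s + t + u) \<le> Suc w * (Suc (test_weight b) + (n - k) * ?r)"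
      using u(2) by linarith
    then show ?case
      using exec.WhileTrue[OF b t(1) u(1)] u(3,4) by blast
  qed
  have "Suc w * (Suc (test_weight b) + n * ?r) \<le> Suc w * prog_weight m (While b c)"
    unfolding prog_weight.simps using \<open>n \<le> m\<close> by (intro mult_left_mono add_left_mono mult_right_mono) auto
  then show ?thesis
    unfolding triple_def using run[of 0] by (metis diff_zero le0 order.trans)
qed

subsection \<open>List scheduling\<close>

text \<open>Polymorphic in the weights, which are the scaled natural times in the program, the real
  system times in the analysis, and constantly 1 when jobs are counted.\<close>

definition load :: "(nat \<Rightarrow> nat) \<Rightarrow> (nat \<Rightarrow> 'a::comm_monoid_add) \<Rightarrow> nat \<Rightarrow> nat \<Rightarrow> 'a" where
  "load f q i v = (\<Sum>k<i. if f k = v then q k else 0)"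

definition list_schedule ::
    "nat set \<Rightarrow> (nat \<Rightarrow> 'a::{comm_monoid_add,ord}) \<Rightarrow> nat \<Rightarrow> (nat \<Rightarrow> nat) \<Rightarrow> bool" where
  "list_schedule S q n f \<longleftrightarrow>
     (\<forall>j<n. f j \<in> S \<and> (\<forall>v\<in>S. load f q j (f j) \<le> load f q j v))"

lemma load_0 [simp]: "load f q 0 v = 0"
  and load_Suc: "load f q (Suc i) v = load f q i v + (if f i = v then q i else 0)"
  by (simp_all add: load_def)

lemma load_cong: "(\<And>k. k < i \<Longrightarrow> f k = g k) \<Longrightarrow> load f q i = load g q i"
  by (auto simp: load_def fun_eq_iff intro!: sum.cong)

lemma load_update [simp]: "i \<le> k \<Longrightarrow> load (f(k := v)) q i = load f q i"
  by (intro load_cong) simp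

lemma list_schedule_0 [simp]: "list_schedule S q 0 f"
  by (simp add: list_schedule_def)

lemma list_schedule_extend:
  assumes "list_schedule S q i f" "b \<in> S" "\<And>v. v \<in> S \<Longrightarrow> load f q i b \<le> load f q i v"
  shows "list_schedule S q (Suc i) (f(i := b))"
  using assms by (auto simp: list_schedule_def less_Suc_eq)

lemma sum_load:
  assumes "finite S" "\<And>k. k < i \<Longrightarrow> f k \<in> S"
  shows "(\<Sum>v\<in>S. load f q i v) = (\<Sum>k<i. q k)"
proof -
  have "(\<Sum>v\<in>S. load f q i v) = (\<Sum>k<i. \<Sum>v\<in>S. if f k = v then q k else 0)"
    unfolding load_def by (rule sum.swap)
  also have "\<dots> = (\<Sum>k<i. q k)"
    using assms by (intro sum.cong) simp_all
  finally show ?thesis .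
qed

text \<open>A least load is at most the average load, and the loads on \<open>S\<close> add up to
  the work of all earlier jobs.\<close>

lemma list_schedule_load_le_average:
  fixes q :: "nat \<Rightarrow> 'a::linordered_semidom"
  assumes "list_schedule S q n f" "finite S" "j < n"
  shows "of_nat (card S) * load f q j (f j) \<le> (\<Sum>k<j. q k)"
proof -
  have "of_nat (card S) * load f q j (f j) = (\<Sum>v\<in>S. load f q j (f j))"
    by simp
  also have "\<dots> \<le> (\<Sum>v\<in>S. load f q j v)"
    using assms by (intro sum_mono) (simp add: list_schedule_def)
  also have "\<dots> = (\<Sum>k<j. q k)"
    using assms by (intro sum_load) (auto simp: list_schedule_def)
  finally show ?thesis .
qed

lemma load_mono:
  fixes q :: "nat \<Rightarrow> 'a::ordered_comm_monoid_add"
  assumes "i \<le> j" "\<And>k. k < j \<Longrightarrow> q k \<ge> 0"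
  shows "load f q i v \<le> load f q j v"
  unfolding load_def using assms by (intro sum_mono2) auto

lemma load_le_sum:
  fixes q :: "nat \<Rightarrow> nat"
  shows "load f q i v \<le> (\<Sum>k<i. q k)"
  unfolding load_def by (intro sum_mono) simp

subsection \<open>A program for list scheduling\<close>

abbreviation var :: "string \<Rightarrow> exp" where
  "var x \<equiv> Read x (Num 0)"

abbreviation assign :: "string \<Rightarrow> exp \<Rightarrow> prog" where
  "assign x \<equiv> Write x (Num 0)"

abbreviation num_jobs_exp :: exp where
  "num_jobs_exp \<equiv> Read ''in'' (Num 1)"

abbreviation num_machines_exp :: exp where
  "num_machines_exp \<equiv> Read ''in'' (Num 2)"

text \<open>Layout of the array \<open>in\<close>: entries 0 to 2 hold the length and the numbers of
  jobs and machines; then come the adjacency matrix, one bit per machine for the given set, and six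
  numbers per job.\<close>

definition member_exp :: exp where
  "member_exp = Read ''in'' (Add (Num 3) (Add (Mul num_machines_exp num_machines_exp) (var ''v'')))"

text \<open>Even \<open>r\<close> gives the numerators of the three parameters of a job, odd
  \<open>r\<close> the denominators.\<close>

definition param_exp :: "nat \<Rightarrow> exp" where
  "param_exp r = Read ''in'' (Add (Num (3 + r)) (Add (Mul num_machines_exp num_machines_exp)
     (Add num_machines_exp (Mul (Num 6) (var ''i'')))))"

definition denominator_loop :: prog where
  "denominator_loop = While (Less (var ''i'') num_jobs_exp)
     (Seq (assign ''D'' (Mul (var ''D'') (Mul (param_exp 1) (Mul (param_exp 3) (param_exp 5)))))
          (assign ''i'' (Add (var ''i'') (Num 1))))"

text \<open>The number of machines serves as the value of \<open>best\<close> before the first member is found.\<close>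

definition least_load_loop :: prog where
  "least_load_loop = While (Less (var ''v'') num_machines_exp)
     (Seq (If (And (Less (Num 0) member_exp)
                   (Not (And (Less (var ''best'') num_machines_exp)
                             (Not (Less (Read ''load'' (var ''v'')) (Read ''load'' (var ''best'')))))))
              (assign ''best'' (var ''v''))
              Skip)
          (assign ''v'' (Add (var ''v'') (Num 1))))"

text \<open>The divisions are exact, as every denominator divides \<open>D\<close>; the value is
  \<open>D\<close> times the system time.\<close>

definition scaled_time_exp :: exp where
  "scaled_time_exp = Add (Mul (Div (var ''D'') (param_exp 1)) (param_exp 0))
     (Add (Mul (Div (var ''D'') (param_exp 3)) (param_exp 2))
          (Mul (Div (var ''D'') (param_exp 5)) (param_exp 4)))"

abbreviation out_exp :: "nat \<Rightarrow> exp" where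
  "out_exp r \<equiv> Add (Mul (Num 3) (var ''i'')) (Num r)"

text \<open>The starting time is output as the fraction of load and \<open>D\<close>, before the
  load is increased by the job. The offsets 1 to 3 leave entry 0 of \<open>out\<close> to the
  length.\<close>

definition job_loop :: prog where
  "job_loop = While (Less (var ''i'') num_jobs_exp)
     (Seq (assign ''best'' num_machines_exp)
     (Seq (assign ''v'' (Num 0))
     (Seq least_load_loop
     (Seq (Write ''out'' (out_exp 1) (var ''best''))
     (Seq (Write ''out'' (out_exp 2) (Read ''load'' (var ''best'')))
     (Seq (Write ''out'' (out_exp 3) (var ''D''))
     (Seq (Write ''load'' (var ''best'') (Add (Read ''load'' (var ''best'')) scaled_time_exp))
          (assign ''i'' (Add (var ''i'') (Num 1))))))))))"

text \<open>The first loop and the initial loads rely on every array other than \<open>in\<close>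
  being 0 at the start.\<close>

definition list_scheduling :: prog where
  "list_scheduling =
     Seq (assign ''D'' (Num 1))
    (Seq denominator_loop
    (Seq (assign ''i'' (Num 0))
    (Seq (Write ''out'' (Num 0) (Mul (Num 3) num_jobs_exp))
         job_loop)))"

text \<open>Abstracts from the encoding of instances. The bounds at the end keep all stored values
  below \<open>2 ^ w\<close>: partial products of denominators, loads, counters and output
  entries.\<close>

locale list_scheduling_input =
  fixes inp :: "nat \<Rightarrow> nat" and S :: "nat set" and w N n m D :: nat
    and a :: "nat \<Rightarrow> nat \<Rightarrow> nat" and den Q :: "nat \<Rightarrow> nat"
  assumes inp_1: "inp (Suc 0) = n" and inp_2: "inp 2 = m"
    and a_def: "\<And>j r. a j r = inp (3 + r + (m * m + (m + 6 * j)))"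
    and den_def: "\<And>j. den j = a j 1 * (a j 3 * a j 5)"
    and D_def: "D = (\<Prod>j<n. den j)"
    and Q_def: "\<And>j. Q j = D div a j 1 * a j 0 + (D div a j 3 * a j 2 + D div a j 5 * a j 4)"
    and member: "\<And>v. v < m \<Longrightarrow> inp (3 + (m * m + v)) > 0 \<longleftrightarrow> v \<in> S"
    and S: "S \<subseteq> {..<m}" "S \<noteq> {}"
    and den_bound: "\<And>i. i \<le> n \<Longrightarrow> (\<Prod>j<i. den j) < 2 ^ w"
    and Q_bound: "(\<Sum>j<n. Q j) < 2 ^ w"
    and n_bound: "3 * n + 3 < 2 ^ w" "n \<le> N"
    and m_bound: "m < 2 ^ w" "m \<le> N"
begin

text \<open>Invariant of the outer loop after \<open>i\<close> jobs. It says nothing about entries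
  of \<open>out\<close> beyond \<open>3 * i\<close>, so the three writes for job \<open>i\<close>
  preserve it.\<close>

definition job_state :: "nat \<Rightarrow> store \<Rightarrow> bool" where
  "job_state i s \<longleftrightarrow> s ''in'' = inp \<and> s ''D'' 0 = D \<and> s ''out'' 0 = 3 * n \<and>
     (\<exists>f. list_schedule S Q i f \<and> s ''load'' = load f Q i \<and>
        (\<forall>j<i. s ''out'' (3 * j + 1) = f j \<and> s ''out'' (3 * j + 2) = load f Q j (f j) \<and>
               s ''out'' (3 * j + 3) = D))"

lemma job_state_update [simp]:
  assumes "x \<notin> {''in'', ''D'', ''out'', ''load''}"
  shows "job_state i (s(x := h)) \<longleftrightarrow> job_state i s"
proof -
  have "(s(x := h)) y = s y" if "y \<in> {''in'', ''D'', ''out'', ''load''}" for y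
    using assms that by (metis fun_upd_other)
  then show ?thesis
    by (simp add: job_state_def del: fun_upd_apply)
qed

lemma job_state_write_out:
  assumes "job_state i s" "k > 3 * i"
  shows "job_state i (s(''out'' := (s ''out'')(k := y)))"
proof -
  have "3 * j + 1 \<noteq> k" "3 * j + 2 \<noteq> k" "3 * j + 3 \<noteq> k" if "j < i" for j
    using that assms(2) by auto
  then show ?thesis
    using assms by (simp add: job_state_def)
qed

lemma job_stateD:
  assumes "job_state i s"
  shows "s ''in'' = inp" "s ''D'' 0 = D" "s ''load'' v \<le> (\<Sum>j<i. Q j)"
  using assms load_le_sum by (auto simp: job_state_def)

text \<open>Invariant of the inner loop after the machines below \<open>v\<close>. In the first
  disjunct the scan has not yet met \<open>S\<close> and \<open>best\<close> has its default value
  \<open>m\<close>; this is impossible at \<open>v = m\<close>, as \<open>S\<close> is a nonempty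
  set of machines.\<close>

definition chosen :: "nat \<Rightarrow> nat \<Rightarrow> store \<Rightarrow> bool" where
  "chosen i v s \<longleftrightarrow> job_state i s \<and> s ''i'' 0 = i \<and>
     ((\<forall>u\<in>S. v \<le> u) \<and> s ''best'' 0 = m \<or>
      s ''best'' 0 \<in> S \<and> s ''best'' 0 < v \<and>
        (\<forall>u\<in>S. u < v \<longrightarrow> s ''load'' (s ''best'' 0) \<le> s ''load'' u))"

section \<open>Correctness of the loops\<close>

lemma denominator_loop:
  "triple w N (\<lambda>s. s ''in'' = inp \<and> s ''load'' = (\<lambda>_. 0) \<and> s ''i'' 0 = 0 \<and> s ''D'' 0 = 1)
     denominator_loop (\<lambda>s. s ''in'' = inp \<and> s ''load'' = (\<lambda>_. 0) \<and> s ''D'' 0 = D)"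
proof -
  let ?I = "\<lambda>i s. s ''in'' = inp \<and> s ''load'' = (\<lambda>_. 0) \<and> s ''i'' 0 = i \<and> s ''D'' 0 = (\<Prod>j<i. den j)"
  have "triple w N (?I 0) denominator_loop (?I n)"
    unfolding denominator_loop_def
  proof (rule triple_While)
    fix k assume "k < n"
    let ?R = "\<lambda>s. s ''in'' = inp \<and> s ''load'' = (\<lambda>_. 0) \<and> s ''i'' 0 = k \<and>
      s ''D'' 0 = (\<Prod>j<Suc k. den j)"
    show "triple w N (?I k)
      (Seq (assign ''D'' (Mul (var ''D'') (Mul (param_exp 1) (Mul (param_exp 3) (param_exp 5)))))
          (assign ''i'' (Add (var ''i'') (Num 1)))) (?I (Suc k))"
    proof (rule triple_Seq[where R = ?R])
      show "triple w N (?I k)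
        (assign ''D'' (Mul (var ''D'') (Mul (param_exp 1) (Mul (param_exp 3) (param_exp 5))))) ?R"
        using den_bound[of "Suc k"] \<open>k < n\<close>
        by (intro triple_Write) (simp add: param_exp_def den_def a_def inp_2)
      show "triple w N ?R (assign ''i'' (Add (var ''i'') (Num 1))) (?I (Suc k))"
        using n_bound \<open>k < n\<close> by (intro triple_Write) simp
    qed
  qed (use n_bound in \<open>auto simp: inp_1\<close>)
  then show ?thesis
    by (rule triple_conseq) (auto simp: D_def)
qed

lemma least_load_loop:
  "triple w N (\<lambda>s. chosen i 0 s \<and> s ''v'' 0 = 0) least_load_loop (chosen i m)"
proof -
  let ?I = "\<lambda>v s. chosen i v s \<and> s ''v'' 0 = v"
  have "triple w N (?I 0) least_load_loop (?I m)"
    unfolding least_load_loop_def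
  proof (rule triple_While)
    fix v assume v: "v < m"
    let ?R = "\<lambda>s. chosen i (Suc v) s \<and> s ''v'' 0 = v"
    let ?b = "And (Less (Num 0) member_exp) (Not (And (Less (var ''best'') num_machines_exp)
      (Not (Less (Read ''load'' (var ''v'')) (Read ''load'' (var ''best''))))))"
    have test: "holds ?b s \<longleftrightarrow> v \<in> S \<and> (s ''best'' 0 < m \<longrightarrow> s ''load'' v < s ''load'' (s ''best'' 0))"
      if "?I v s" for s
      using that member[OF v] job_stateD(1)[of i s]
      by (simp add: chosen_def member_exp_def inp_2)
    show "triple w N (?I v) (Seq (If ?b (assign ''best'' (var ''v'')) Skip)
      (assign ''v'' (Add (var ''v'') (Num 1)))) (?I (Suc v))"
    proof (rule triple_Seq[where R = ?R], rule triple_If)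
      show "triple w N (\<lambda>s. ?I v s \<and> holds ?b s) (assign ''best'' (var ''v'')) ?R"
      proof (rule triple_Write, elim conjE)
        fix s assume s: "bounded_store w s" "chosen i v s" "s ''v'' 0 = v" "holds ?b s"
        then have vS: "v \<in> S" and less: "s ''best'' 0 < m \<longrightarrow> s ''load'' v < s ''load'' (s ''best'' 0)"
          using test by auto
        \<comment> \<open>A member \<open>u\<close> below \<open>v\<close> rules out the default
          value of \<open>best\<close>, so the test did compare \<open>v\<close> with the best
          machine so far.\<close>
        have "s ''load'' v \<le> s ''load'' u" if "u \<in> S" "u < v" for u
        proof -
          have "s ''best'' 0 < v" "s ''load'' (s ''best'' 0) \<le> s ''load'' u"
            using s(2) that by (auto simp: chosen_def)
          then show ?thesis
            using less v by linarith
        qed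
        then show "val (var ''v'') s < 2 ^ w \<and>
          chosen i (Suc v) (s(''best'' := (s ''best'')(val (Num 0) s := val (var ''v'') s))) \<and>
          (s(''best'' := (s ''best'')(val (Num 0) s := val (var ''v'') s))) ''v'' 0 = v"
          using s vS v m_bound by (auto simp: chosen_def less_Suc_eq)
      qed
      show "triple w N (\<lambda>s. ?I v s \<and> \<not> holds ?b s) Skip ?R"
      proof (rule triple_conseq[OF triple_Skip])
        fix s assume s: "?I v s \<and> \<not> holds ?b s"
        then have "v \<notin> S \<or> s ''best'' 0 < m \<and> s ''load'' (s ''best'' 0) \<le> s ''load'' v"
          using test[of s] by (auto simp: not_less simp del: holds.simps)
        then show "?R s"
          using s by (auto simp: chosen_def less_Suc_eq Suc_le_eq le_less)
      qed
      show "triple w N ?R (assign ''v'' (Add (var ''v'') (Num 1))) (?I (Suc v))"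
        using m_bound v by (intro triple_Write) (simp add: chosen_def)
    qed
  next
    fix k s assume "?I k s"
    then show "holds (Less (var ''v'') num_machines_exp) s \<longleftrightarrow> k < m"
      using job_stateD(1)[of i s] by (simp add: chosen_def inp_2)
  qed (use m_bound in simp)
  then show ?thesis
    by (rule triple_conseq) auto
qed

lemma chosen_all:
  assumes "chosen i m s"
  shows "s ''best'' 0 \<in> S" "\<And>u. u \<in> S \<Longrightarrow> s ''load'' (s ''best'' 0) \<le> s ''load'' u"
proof -
  obtain u where "u \<in> S"
    using S by auto
  then have "u < m"
    using S by auto
  show "s ''best'' 0 \<in> S" "\<And>u. u \<in> S \<Longrightarrow> s ''load'' (s ''best'' 0) \<le> s ''load'' u"
    using assms S \<open>u \<in> S\<close> \<open>u < m\<close> by (auto simp: chosen_def)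
qed

lemma val_scaled_time:
  assumes "job_state i s" "s ''i'' 0 = i"
  shows "val scaled_time_exp s = Q i"
  using job_stateD[OF assms(1)] assms(2)
  by (simp add: scaled_time_exp_def param_exp_def Q_def a_def inp_2)

lemma job_state_Suc:
  assumes "chosen i m s" "s ''out'' (3 * i + 1) = s ''best'' 0"
    "s ''out'' (3 * i + 2) = s ''load'' (s ''best'' 0)" "s ''out'' (3 * i + 3) = D"
  shows "job_state (Suc i)
    (s(''load'' := (s ''load'')(s ''best'' 0 := s ''load'' (s ''best'' 0) + Q i)))"
proof -
  let ?b = "s ''best'' 0"
  have st: "job_state i s"
    using assms(1) by (simp add: chosen_def)
  then obtain f where f: "list_schedule S Q i f" "s ''load'' = load f Q i"
    "\<forall>j<i. s ''out'' (3 * j + 1) = f j \<and> s ''out'' (3 * j + 2) = load f Q j (f j) \<and>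
      s ''out'' (3 * j + 3) = D"
    by (auto simp: job_state_def)
  \<comment> \<open>The assignment witnessing the invariant is extended by the machine just found;
    loads up to stage \<open>i\<close> do not see the change.\<close>
  have "list_schedule S Q (Suc i) (f(i := ?b))"
    using chosen_all[OF assms(1)] f(2) by (intro list_schedule_extend[OF f(1)]) auto
  moreover have "(s ''load'')(?b := s ''load'' ?b + Q i) = load (f(i := ?b)) Q (Suc i)"
    by (auto simp: load_Suc f(2))
  moreover have "s ''out'' (3 * j + 1) = (f(i := ?b)) j \<and>
      s ''out'' (3 * j + 2) = load (f(i := ?b)) Q j ((f(i := ?b)) j) \<and> s ''out'' (3 * j + 3) = D"
    if "j < Suc i" for j
    using that assms f(2,3) by (auto simp: less_Suc_eq)
  ultimately show ?thesis
    using st unfolding job_state_def by fastforce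
qed

lemma job_loop:
  "triple w N (\<lambda>s. job_state 0 s \<and> s ''i'' 0 = 0) job_loop (job_state n)"
proof -
  let ?I = "\<lambda>i s. job_state i s \<and> s ''i'' 0 = i"
  have "triple w N (?I 0) job_loop (?I n)"
    unfolding job_loop_def
  proof (rule triple_While)
    fix i assume i: "i < n"
    \<comment> \<open>Any load after this iteration is at most the work of the first
      \<open>Suc i\<close> jobs and hence fits into \<open>w\<close> bits.\<close>
    then have Q_i: "(\<Sum>j<i. Q j) + Q i < 2 ^ w"
      using sum_mono2[of "{..<n}" "{..<Suc i}" Q] Q_bound by auto
    let ?R1 = "\<lambda>s. chosen i m s \<and> s ''out'' (3 * i + 1) = s ''best'' 0"
    let ?R2 = "\<lambda>s. ?R1 s \<and> s ''out'' (3 * i + 2) = s ''load'' (s ''best'' 0)"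
    let ?R3 = "\<lambda>s. ?R2 s \<and> s ''out'' (3 * i + 3) = D"
    have chosen_out: "chosen i m (s(''out'' := (s ''out'')(k := y)))" if "chosen i m s" "k > 3 * i" for s k y
      using that by (auto simp: chosen_def job_state_write_out)
    have chosenD: "s ''i'' 0 = i" "s ''D'' 0 = D" if "chosen i m s" for s
      using that job_stateD(2) by (auto simp: chosen_def)
    have bounded: "s x k < 2 ^ w" if "bounded_store w s" for s x k
      using that by (simp add: bounded_store_def)
    show "triple w N (?I i)
       (Seq (assign ''best'' num_machines_exp)
       (Seq (assign ''v'' (Num 0))
       (Seq least_load_loop
       (Seq (Write ''out'' (out_exp 1) (var ''best''))
       (Seq (Write ''out'' (out_exp 2) (Read ''load'' (var ''best'')))
       (Seq (Write ''out'' (out_exp 3) (var ''D''))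
       (Seq (Write ''load'' (var ''best'') (Add (Read ''load'' (var ''best'')) scaled_time_exp))
            (assign ''i'' (Add (var ''i'') (Num 1)))))))))) (?I (Suc i))"
    proof (intro triple_Seq)
      show "triple w N (?I i) (assign ''best'' num_machines_exp) (chosen i 0)"
        using m_bound job_stateD(1) by (intro triple_Write) (auto simp: chosen_def inp_2)
      show "triple w N (chosen i 0) (assign ''v'' (Num 0)) (\<lambda>s. chosen i 0 s \<and> s ''v'' 0 = 0)"
        by (intro triple_Write) (simp add: chosen_def)
      show "triple w N (\<lambda>s. chosen i 0 s \<and> s ''v'' 0 = 0) least_load_loop (chosen i m)"
        by (rule least_load_loop)
      show "triple w N (chosen i m) (Write ''out'' (out_exp 1) (var ''best'')) ?R1"
        by (intro triple_Write) (auto simp: bounded chosen_out chosenD)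
      show "triple w N ?R1 (Write ''out'' (out_exp 2) (Read ''load'' (var ''best''))) ?R2"
        by (intro triple_Write) (auto simp: bounded chosen_out chosenD)
      show "triple w N ?R2 (Write ''out'' (out_exp 3) (var ''D'')) ?R3"
        using den_bound[of n, folded D_def]
        by (intro triple_Write) (auto simp: bounded chosen_out chosenD)
      show "triple w N ?R3
          (Write ''load'' (var ''best'') (Add (Read ''load'' (var ''best'')) scaled_time_exp))
          (\<lambda>s. job_state (Suc i) s \<and> s ''i'' 0 = i)"
      proof (rule triple_Write)
        fix s assume s: "?R3 s"
        then have st: "job_state i s" "s ''i'' 0 = i"
          by (auto simp: chosen_def)
        then have "val (Add (Read ''load'' (var ''best'')) scaled_time_exp) s
            = s ''load'' (s ''best'' 0) + Q i"
          by (simp add: val_scaled_time)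
        then show "val (Add (Read ''load'' (var ''best'')) scaled_time_exp) s < 2 ^ w \<and>
          job_state (Suc i) (s(''load'' := (s ''load'')(val (var ''best'') s :=
            val (Add (Read ''load'' (var ''best'')) scaled_time_exp) s))) \<and>
          (s(''load'' := (s ''load'')(val (var ''best'') s :=
            val (Add (Read ''load'' (var ''best'')) scaled_time_exp) s))) ''i'' 0 = i"
          using job_state_Suc s st job_stateD(3)[OF st(1), of "s ''best'' 0"] Q_i by simp
      qed
      show "triple w N (\<lambda>s. job_state (Suc i) s \<and> s ''i'' 0 = i)
          (assign ''i'' (Add (var ''i'') (Num 1))) (?I (Suc i))"
        using i n_bound by (intro triple_Write) simp
    qed
  next
    fix k s assume "?I k s"
    then show "holds (Less (var ''i'') num_jobs_exp) s \<longleftrightarrow> k < n"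
      using job_stateD(1)[of k s] by (simp add: inp_1)
  qed (use n_bound in simp)
  then show ?thesis
    by (rule triple_conseq) auto
qed

lemma list_scheduling_correct:
  "triple w N (\<lambda>s. s ''in'' = inp \<and> s ''load'' = (\<lambda>_. 0) \<and> s ''i'' 0 = 0)
     list_scheduling (job_state n)"
  unfolding list_scheduling_def
proof (intro triple_Seq)
  show "triple w N (\<lambda>s. s ''in'' = inp \<and> s ''load'' = (\<lambda>_. 0) \<and> s ''i'' 0 = 0) (assign ''D'' (Num 1))
    (\<lambda>s. s ''in'' = inp \<and> s ''load'' = (\<lambda>_. 0) \<and> s ''i'' 0 = 0 \<and> s ''D'' 0 = 1)"
    using n_bound by (intro triple_Write) auto
  show "triple w N (\<lambda>s. s ''in'' = inp \<and> s ''load'' = (\<lambda>_. 0) \<and> s ''D'' 0 = D)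
    (assign ''i'' (Num 0))
    (\<lambda>s. s ''in'' = inp \<and> s ''load'' = (\<lambda>_. 0) \<and> s ''D'' 0 = D \<and> s ''i'' 0 = 0)"
    by (intro triple_Write) auto
  show "triple w N (\<lambda>s. s ''in'' = inp \<and> s ''load'' = (\<lambda>_. 0) \<and> s ''D'' 0 = D \<and> s ''i'' 0 = 0)
    (Write ''out'' (Num 0) (Mul (Num 3) num_jobs_exp)) (\<lambda>s. job_state 0 s \<and> s ''i'' 0 = 0)"
    using n_bound by (intro triple_Write) (auto simp: job_state_def inp_1 fun_eq_iff)
qed (rule denominator_loop job_loop)+

end

subsection \<open>Encodings\<close>

lemma list_size_simps [simp]:
  "list_size [] = 0" "list_size (x # xs) = nat_size x + list_size xs"
  "list_size (xs @ ys) = list_size xs + list_size ys"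
  by (simp_all add: list_size_def)

lemma list_size_concat: "list_size (concat (map f [0..<n])) = (\<Sum>j<n. list_size (f j))"
  by (induction n) simp_all

lemma length_le_list_size: "length xs \<le> list_size xs"
proof (induction xs)
  case (Cons x xs)
  then show ?case
    using nat_size_pos[of x] unfolding list_size_simps length_Cons by linarith
qed simp

lemma nat_size_le_list_size: "x \<in> set xs \<Longrightarrow> nat_size x \<le> list_size xs"
  by (induction xs) auto

lemma length_concat_uniform:
  "(\<And>j. j < n \<Longrightarrow> length (f j) = l) \<Longrightarrow> length (concat (map f [0..<n])) = l * n"
  by (induction n) simp_all

lemma nth_concat_uniform:
  assumes "\<And>j. j < n \<Longrightarrow> length (f j) = l" "i < n" "r < l"
  shows "concat (map f [0..<n]) ! (l * i + r) = f i ! r"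
  using assms
proof (induction n)
  case (Suc n)
  have len: "length (concat (map f [0..<n])) = l * n"
    by (rule length_concat_uniform) (simp add: Suc.prems)
  show ?case
  proof (cases "i = n")
    case True
    then show ?thesis using len by (simp add: nth_append)
  next
    case False
    then have "i < n" using Suc.prems by simp
    then have "l * Suc i \<le> l * n"
      by (intro mult_left_mono) auto
    then have "l * i + r < l * n"
      using Suc.prems by simp
    then show ?thesis
      using len Suc \<open>i < n\<close> by (simp add: nth_append)
  qed
qed simp

section \<open>Scaled parameters and the run of the program on an encoded instance\<close>

lemma encode_rat_triple:
  "encode_rat x @ encode_rat y @ encode_rat z =
     [nat (fst (quotient_of x)), nat (snd (quotient_of x)), nat (fst (quotient_of y)),
      nat (snd (quotient_of y)), nat (fst (quotient_of z)), nat (snd (quotient_of z))]"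
  by (simp add: encode_rat_def)

text \<open>With \<open>x = a / b\<close> and \<open>D = b * k\<close>, both sides are
  \<open>k * a\<close>.\<close>

lemma scaled_rat:
  assumes "x \<ge> 0" "nat (snd (quotient_of x)) dvd D"
  shows "of_nat (D div nat (snd (quotient_of x)) * nat (fst (quotient_of x))) = of_nat D * x"
proof -
  obtain a b where ab: "quotient_of x = (a, b)" by fastforce
  then have x: "x = of_int a / of_int b" and b: "b > 0"
    using quotient_of_div quotient_of_denom_pos by blast+
  then have a: "a \<ge> 0"
    using assms(1) by (simp add: zero_le_divide_iff)
  obtain k where k: "D = nat b * k"
    using assms(2) ab by auto
  have "of_nat (D div nat b * nat a) = (of_nat k * of_int a :: rat)"
    using a b by (simp add: k)
  also have "\<dots> = of_nat D * x"
    using b by (simp add: k x)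
  finally show ?thesis using ab by simp
qed

text \<open>Interface between program and analysis: the ratios are proved for every such schedule,
  however ties are broken.\<close>

definition is_list_schedule :: "smc_instance \<Rightarrow> nat set \<Rightarrow> schedule \<Rightarrow> bool" where
  "is_list_schedule I S \<sigma> \<longleftrightarrow>
     list_schedule S (\<lambda>j. of_rat (system_time I j) :: real) (num_jobs I) (machine \<sigma>) \<and>
     (\<forall>j\<in>jobs I. start \<sigma> j = load (machine \<sigma>) (\<lambda>j. of_rat (system_time I j)) j (machine \<sigma> j))"

lemma list_scheduling_encode:
  assumes I: "smc I" and S: "independent I S" "S \<noteq> {}"
  defines "N \<equiv> list_size (encode (I, S))"
  shows "\<exists>t s \<sigma>. exec list_scheduling (input_store (encode (I, S))) t s \<and>
    t \<le> Suc (3 * N + 3) * prog_weight N list_scheduling \<and>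
    decodes_to I (output_of s) \<sigma> \<and> is_list_schedule I S \<sigma>"
proof -
  let ?n = "num_jobs I" and ?m = "num_machines I"
  let ?f = "\<lambda>j. encode_rat (first_block I j) @ encode_rat (proc I j) @ encode_rat (second_block I j)"
  define A where "A = concat (map (\<lambda>u. map (\<lambda>v. of_bool ({u, v} \<in> conflicts I) :: nat) [0..<?m]) [0..<?m])"
  define B where "B = map (\<lambda>v. of_bool (v \<in> S) :: nat) [0..<?m]"
  define P where "P = concat (map ?f [0..<?n])"
  define xs where "xs = encode (I, S)"
  have xs: "xs = ?n # ?m # A @ B @ P"
    by (simp add: xs_def encode_def A_def B_def P_def)
  have lenA: "length A = ?m * ?m"
    unfolding A_def by (rule length_concat_uniform) simp
  have lenB: "length B = ?m"
    by (simp add: B_def)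
  have lenf: "length (?f j) = 6" for j
    by (simp add: encode_rat_def)
  have lenP: "length P = 6 * ?n"
    unfolding P_def by (rule length_concat_uniform) (rule lenf)
  have N: "N = list_size xs"
    by (simp add: N_def xs_def)
  have lenN: "2 + ?m * ?m + ?m + 6 * ?n \<le> N"
    using length_le_list_size[of xs] by (simp add: N xs lenA lenB lenP)
  define inp where "inp = input_store xs ''in''"
  have inp: "inp k = (if k \<le> length xs then (length xs # xs) ! k else 0)" for k
    by (simp add: inp_def input_store_def)
  have inp_less: "inp k < 2 ^ N" for k
  proof (cases "k = 0 \<or> k > length xs")
    case True
    then have "inp k \<le> length xs"
      by (auto simp: inp)
    also have "\<dots> \<le> N"
      using length_le_list_size by (simp add: N)
    also have "N < 2 ^ N"
      by (rule less_exp)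
    finally show ?thesis .
  next
    case False
    then have "inp k \<in> set xs"
      by (auto simp: inp nth_Cons split: nat.split)
    then have "nat_size (inp k) \<le> N"
      using nat_size_le_list_size by (simp add: N)
    then have "(2::nat) ^ nat_size (inp k) \<le> 2 ^ N"
      by (rule power_increasing) simp
    then show ?thesis
      using less_power_nat_size[of "inp k"] by linarith
  qed
  define a where "a j r = inp (3 + r + (?m * ?m + (?m + 6 * j)))" for j r
  have a: "a j r = ?f j ! r" if "j < ?n" "r < 6" for j r
  proof -
    \<comment> \<open>The three successors skip the length and the two counts in front of the
      matrix.\<close>
    have "3 + r + (?m * ?m + (?m + 6 * j)) = Suc (Suc (Suc (?m * ?m + (?m + (6 * j + r)))))"
      by simp
    then have "a j r = P ! (6 * j + r)"
      using that by (simp only: a_def) (simp add: inp xs lenA lenB lenP nth_append)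
    also have "\<dots> = ?f j ! r"
      unfolding P_def by (rule nth_concat_uniform[OF lenf that])
    finally show ?thesis .
  qed
  define den where "den j = a j 1 * (a j 3 * a j 5)" for j
  define D where "D = (\<Prod>j<?n. den j)"
  define Q where "Q j = D div a j 1 * a j 0 + (D div a j 3 * a j 2 + D div a j 5 * a j 4)" for j
  have a_less: "a j r < 2 ^ N" for j r
    by (simp add: a_def inp_less)
  \<comment> \<open>Multiplying numbers adds their binary lengths, so the product of all
    denominators has no more bits than the input has size.\<close>
  have den_le: "den j \<le> 2 ^ list_size (?f j)" if "j < ?n" for j
  proof -
    have "den j \<le> 2 ^ nat_size (a j 1) * (2 ^ nat_size (a j 3) * 2 ^ nat_size (a j 5))"
      unfolding den_def by (intro mult_le_mono less_imp_le less_power_nat_size)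
    also have "\<dots> = 2 ^ (nat_size (a j 1) + nat_size (a j 3) + nat_size (a j 5))"
      by (simp add: power_add)
    also have "\<dots> \<le> 2 ^ list_size (?f j)"
      using that by (intro power_increasing) (simp_all add: a encode_rat_def)
    finally show ?thesis .
  qed
  have den_prod: "(\<Prod>j<i. den j) \<le> 2 ^ N" if "i \<le> ?n" for i
  proof -
    have "(\<Prod>j<i. den j) \<le> (\<Prod>j<i. 2 ^ list_size (?f j))"
      using that by (intro prod_mono conjI le0 den_le) auto
    also have "\<dots> = 2 ^ (\<Sum>j<i. list_size (?f j))"
      by (rule power_sum[symmetric])
    also have "\<dots> \<le> 2 ^ N"
    proof (rule power_increasing)
      have "(\<Sum>j<i. list_size (?f j)) \<le> (\<Sum>j<?n. list_size (?f j))"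
        using that by (intro sum_mono2) auto
      also have "\<dots> = list_size P"
        by (simp only: P_def list_size_concat)
      also have "\<dots> \<le> N"
        by (simp add: N xs)
      finally show "(\<Sum>j<i. list_size (?f j)) \<le> N" .
    qed simp
    finally show ?thesis .
  qed
  \<comment> \<open>Origin of \<open>3 * N + 3\<close>: \<open>D\<close> and each numerator are at
    most \<open>2 ^ N\<close>, so a scaled system time is at most \<open>3 * 2 ^ (2 * N)\<close>,
    and the sum over at most \<open>2 ^ N\<close> jobs stays below
    \<open>8 * 2 ^ (3 * N)\<close>.\<close>
  have "3 * N + 3 = 3 + (N + (N + N))"
    by simp
  then have power_N: "(2::nat) ^ (3 * N + 3) = 8 * (2 ^ N * (2 ^ N * 2 ^ N))"
    by (simp only: power_add) simp
  have one_le: "(1::nat) \<le> 2 ^ N * 2 ^ N"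
    by simp
  have "2 ^ N * 1 \<le> (2::nat) ^ N * (2 ^ N * 2 ^ N)"
    by (intro mult_left_mono one_le) simp
  then have small: "8 * 2 ^ N \<le> (2::nat) ^ (3 * N + 3)"
    unfolding power_N by simp
  have N_less: "N < 2 ^ N"
    by (rule less_exp)
  have nm: "?n \<le> 2 ^ N" "?m \<le> 2 ^ N"
    using lenN N_less by linarith+
  have D_le: "D \<le> 2 ^ N"
    unfolding D_def by (rule den_prod) simp
  have quot: "D div d * e \<le> 2 ^ N * 2 ^ N" if "e < 2 ^ N" for d e
    using that by (intro mult_le_mono order.trans[OF div_le_dividend D_le]) simp
  have Q_le: "Q j \<le> 3 * (2 ^ N * 2 ^ N)" for j
    unfolding Q_def
    using quot[of "a j 0" "a j 1"] quot[of "a j 2" "a j 3"] quot[of "a j 4" "a j 5"] a_less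
    by simp
  have "list_scheduling_input inp S (3 * N + 3) N ?n ?m D a den Q"
  proof
    show "0 < inp (3 + (?m * ?m + v)) \<longleftrightarrow> v \<in> S" if "v < ?m" for v
      using that by (simp add: inp xs lenA lenB lenP nth_append B_def)
    show "S \<subseteq> {..<?m}"
      using S by (auto simp: independent_def machines_def)
    show "(\<Prod>j<i. den j) < 2 ^ (3 * N + 3)" if "i \<le> ?n" for i
      using den_prod[OF that] small N_less by linarith
    have "(\<Sum>j<?n. Q j) \<le> (\<Sum>j<?n. 3 * (2 ^ N * 2 ^ N))"
      by (intro sum_mono Q_le)
    also have "\<dots> = ?n * (3 * (2 ^ N * 2 ^ N))"
      by simp
    also have "\<dots> \<le> 2 ^ N * (3 * (2 ^ N * 2 ^ N))"
      using nm by (intro mult_right_mono) auto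
    also have "\<dots> < 2 ^ (3 * N + 3)"
      unfolding power_N by simp
    finally show "(\<Sum>j<?n. Q j) < 2 ^ (3 * N + 3)" .
    show "3 * ?n + 3 < 2 ^ (3 * N + 3)" "?m < 2 ^ (3 * N + 3)"
      using lenN nm N_less small by linarith+
  qed (use S lenN in \<open>simp_all add: inp xs a_def den_def D_def Q_def\<close>)
  then interpret list_scheduling_input inp S "3 * N + 3" N ?n ?m D a den Q .
  have bounded: "bounded_store (3 * N + 3) (input_store xs)"
    unfolding bounded_store_def
  proof (intro allI)
    fix x k
    show "input_store xs x k < 2 ^ (3 * N + 3)"
    proof (cases "x = ''in''")
      case True
      have "inp k < 2 ^ (3 * N + 3)"
        using inp_less[of k] small by linarith
      with True show ?thesis by (simp add: inp_def)
    qed (simp add: input_store_def)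
  qed
  have "input_store xs ''in'' = inp \<and> input_store xs ''load'' = (\<lambda>_. 0) \<and> input_store xs ''i'' 0 = 0"
    unfolding inp_def by (simp add: input_store_def)
  with list_scheduling_correct bounded obtain t s where ts: "exec list_scheduling (input_store xs) t s"
    "t \<le> Suc (3 * N + 3) * prog_weight N list_scheduling" "job_state ?n s"
    unfolding triple_def by blast
  obtain f where f: "list_schedule S Q ?n f" "s ''out'' 0 = 3 * ?n"
    "\<And>j. j < ?n \<Longrightarrow> s ''out'' (3 * j + 1) = f j \<and> s ''out'' (3 * j + 2) = load f Q j (f j) \<and>
       s ''out'' (3 * j + 3) = D"
    using ts(3) by (auto simp: job_state_def)
  let ?q = "\<lambda>j. of_rat (system_time I j) :: real"
  have den_pos: "den j > 0" if "j < ?n" for j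
    using that quotient_of_denom_pos' by (simp add: den_def a encode_rat_triple nth_Cons')
  then have D_pos: "D > 0"
    by (simp add: D_def)
  have Q: "real (Q j) = real D * ?q j" if j: "j < ?n" for j
  proof -
    have "den j dvd D"
      using j by (auto simp: D_def)
    then have dvd: "a j 1 dvd D" "a j 3 dvd D" "a j 5 dvd D"
      by (auto simp: den_def intro: dvd_trans[rotated])
    have nonneg: "first_block I j \<ge> 0" "proc I j \<ge> 0" "second_block I j \<ge> 0"
      using I j by (auto simp: smc_def jobs_def)
    have "rat_of_nat (D div a j 1 * a j 0) = of_nat D * first_block I j"
      "rat_of_nat (D div a j 3 * a j 2) = of_nat D * proc I j"
      "rat_of_nat (D div a j 5 * a j 4) = of_nat D * second_block I j"
      using nonneg dvd j by (simp_all only: a encode_rat_triple) (simp_all add: scaled_rat del: of_nat_mult)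
    then have "rat_of_nat (Q j) = of_nat D * system_time I j"
      unfolding Q_def of_nat_add by (simp add: system_time_def distrib_left del: of_nat_mult)
    then have "(of_rat (rat_of_nat (Q j)) :: real) = of_rat (of_nat D * system_time I j)"
      by simp
    then show ?thesis
      by (simp add: of_rat_mult)
  qed
  have load: "real (load f Q i v) = real D * load f ?q i v" if "i \<le> ?n" for i v
    using that Q by (auto simp: load_def sum_distrib_left intro!: sum.cong)
  \<comment> \<open>Division by the positive number \<open>D\<close> turns scaled loads back into
    real ones and preserves all comparisons between them.\<close>
  define \<sigma> where "\<sigma> = \<lparr>machine = f, start = (\<lambda>j. real (load f Q j (f j)) / real D)\<rparr>"
  have "is_list_schedule I S \<sigma>"
    unfolding is_list_schedule_def list_schedule_def
  proof (intro conjI ballI allI impI)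
    fix j assume j: "j < ?n"
    show "machine \<sigma> j \<in> S"
      using f(1) j by (simp add: \<sigma>_def list_schedule_def)
    fix v assume "v \<in> S"
    then have "real (load f Q j (f j)) \<le> real (load f Q j v)"
      using f(1) j by (simp add: list_schedule_def)
    then show "load (machine \<sigma>) ?q j (machine \<sigma> j) \<le> load (machine \<sigma>) ?q j v"
      using j D_pos by (simp add: load \<sigma>_def)
  qed (use D_pos in \<open>simp add: \<sigma>_def load jobs_def\<close>)
  moreover have "decodes_to I (output_of s) \<sigma>"
  proof -
    \<comment> \<open>Entry 0 of \<open>out\<close> holds the length, which shifts all positions by
      one.\<close>
    have out: "output_of s ! k = s ''out'' (Suc k)" if "k < 3 * ?n" for k
      using that f(2) by (simp add: output_of_def del: upt_Suc)
    have "machine \<sigma> j = output_of s ! (3 * j) \<and> output_of s ! (3 * j + 2) > 0 \<and>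
        start \<sigma> j = real (output_of s ! (3 * j + 1)) / real (output_of s ! (3 * j + 2))"
      if "j < ?n" for j
      using that f(3)[OF that] D_pos out[of "3 * j"] out[of "3 * j + 1"] out[of "3 * j + 2"]
      by (simp add: \<sigma>_def numeral_3_eq_3)
    then show ?thesis
      using f(2) by (simp add: decodes_to_def jobs_def output_of_def)
  qed
  ultimately show ?thesis
    using ts by (auto simp: xs_def)
qed

subsection \<open>Approximation ratios\<close>

lemma is_list_schedule_completion:
  assumes "is_list_schedule I S \<sigma>" "j \<in> jobs I"
  shows "completion I \<sigma> j =
    load (machine \<sigma>) (\<lambda>j. of_rat (system_time I j)) (Suc j) (machine \<sigma> j)"
  using assms by (simp add: is_list_schedule_def completion_def load_Suc)

text \<open>Jobs on one machine queue up in the order of their indices because loads only grow, and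
  distinct machines of an independent set are not in conflict.\<close>

lemma is_list_schedule_conflict_free:
  assumes I: "smc I" and S: "independent I S" and \<sigma>: "is_list_schedule I S \<sigma>"
  shows "conflict_free I \<sigma>"
proof -
  let ?q = "\<lambda>j. of_rat (system_time I j) :: real"
  have q: "?q j \<ge> 0" if "j < num_jobs I" for j
    using system_time_nonneg[OF I] that by (simp add: jobs_def)
  have start: "start \<sigma> j = load (machine \<sigma>) ?q j (machine \<sigma> j)" if "j \<in> jobs I" for j
    using \<sigma> that by (simp add: is_list_schedule_def)
  have mem: "machine \<sigma> j \<in> S" if "j \<in> jobs I" for j
    using \<sigma> that by (auto simp: is_list_schedule_def list_schedule_def jobs_def)
  have order: "completion I \<sigma> j \<le> start \<sigma> k"
    if "j \<in> jobs I" "k \<in> jobs I" "machine \<sigma> j = machine \<sigma> k" "j < k" for j k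
    using that start[of k] is_list_schedule_completion[OF \<sigma>, of j]
      load_mono[of "Suc j" k ?q "machine \<sigma>" "machine \<sigma> k"] q by (simp add: jobs_def)
  have "start \<sigma> j \<ge> 0" if "j \<in> jobs I" for j
    using that start[of j] load_mono[of 0 j ?q "machine \<sigma>" "machine \<sigma> j"] q by (simp add: jobs_def)
  moreover have "machine \<sigma> j \<in> machines I" if "j \<in> jobs I" for j
    using mem[OF that] S by (auto simp: independent_def)
  moreover have "{start \<sigma> j<..<completion I \<sigma> j} \<inter> {start \<sigma> k<..<completion I \<sigma> k} = {}"
    if "j \<in> jobs I" "k \<in> jobs I" "j \<noteq> k" "machine \<sigma> j = machine \<sigma> k" for j k
    using order[OF that(1,2)] order[OF that(2,1)] that(3,4)
    by (cases j k rule: linorder_cases) fastforce+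
  moreover have "{machine \<sigma> j, machine \<sigma> k} \<notin> conflicts I"
    if "j \<in> jobs I" "k \<in> jobs I" for j k
  proof (cases "machine \<sigma> j = machine \<sigma> k")
    case True
    then show ?thesis using I by (auto simp: smc_def)
  next
    case False
    then show ?thesis
      using S mem that by (simp add: independent_def indep_def)
  qed
  ultimately show ?thesis
    unfolding conflict_free_def by blast
qed

text \<open>The schedule \<open>\<sigma>\<close> makes the set of makespans nonempty, so that a
  lower bound passes to its infimum.\<close>

lemma opt_makespan_ge:
  assumes "conflict_free I \<sigma>" "\<And>\<sigma>. conflict_free I \<sigma> \<Longrightarrow> c \<le> makespan I \<sigma>"
  shows "c \<le> opt_makespan I"
  unfolding opt_makespan_def using assms by (intro cInf_greatest) auto

lemma makespan_le:
  assumes "c \<ge> 0" "\<And>j. j \<in> jobs I \<Longrightarrow> completion I \<sigma> j \<le> c"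
  shows "makespan I \<sigma> \<le> c"
  unfolding makespan_def using assms by (intro Max.boundedI) auto

lemma approx_max_independentD:
  assumes "\<gamma> \<ge> 1" "smc I" "approx_max_independent \<gamma> I S"
  shows "independent I S" "finite S" "card S > 0" "real (alpha1 I) \<le> \<gamma> * real (card S)"
    "card S \<le> num_machines I"
proof -
  show S: "independent I S"
    using assms(3) by (simp add: approx_max_independent_def)
  then have sub: "S \<subseteq> {..<num_machines I}"
    by (auto simp: independent_def machines_def)
  then show "finite S"
    using finite_subset by blast
  show "card S \<le> num_machines I"
    using card_mono[OF _ sub] by simp
  show *: "real (alpha1 I) \<le> \<gamma> * real (card S)"
    using assms by (simp add: approx_max_independent_def field_simps)
  show "card S > 0"
    using * alpha1_pos[OF assms(2)] by (cases "card S = 0") auto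
qed

lemma approximation_list_scheduling:
  assumes "\<gamma> \<ge> 1"
    and "\<And>I S \<sigma>. \<lbrakk>smc I; P I; approx_max_independent \<gamma> I S; is_list_schedule I S \<sigma>; conflict_free I \<sigma>\<rbrakk>
      \<Longrightarrow> makespan I \<sigma> \<le> r I * opt_makespan I"
  shows "approximation \<gamma> P r list_scheduling"
proof -
  obtain p where p: "\<And>m. prog_weight m list_scheduling = poly p m"
    using prog_weight_poly by blast
  \<comment> \<open>The factor \<open>[:4, 3:]\<close> is the polynomial for
    \<open>Suc (3 * N + 3)\<close>.\<close>
  have "\<exists>t s. exec list_scheduling (input_store (encode (I, S))) t s \<and>
      t \<le> poly ([:4, 3:] * p) (list_size (encode (I, S))) \<and>
      (\<exists>\<sigma>. decodes_to I (output_of s) \<sigma> \<and> conflict_free I \<sigma> \<and>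
        makespan I \<sigma> \<le> r I * opt_makespan I)"
    if I: "smc I" "P I" "approx_max_independent \<gamma> I S" for I S
  proof -
    note S = approx_max_independentD[OF assms(1) I(1,3)]
    then have "S \<noteq> {}" by auto
    let ?N = "list_size (encode (I, S))"
    obtain t s \<sigma> where run: "exec list_scheduling (input_store (encode (I, S))) t s"
      "t \<le> Suc (3 * ?N + 3) * prog_weight ?N list_scheduling"
      "decodes_to I (output_of s) \<sigma>" "is_list_schedule I S \<sigma>"
      using list_scheduling_encode[OF I(1) S(1) \<open>S \<noteq> {}\<close>] by blast
    have "t \<le> poly ([:4, 3:] * p) ?N"
      using run(2) by (simp add: p algebra_simps)
    moreover have "conflict_free I \<sigma>"
      using is_list_schedule_conflict_free[OF I(1) S(1) run(4)] .
    ultimately show ?thesis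
      using run assms(2)[OF I run(4)] by blast
  qed
  then show ?thesis
    unfolding approximation_def solves_in_polytime_def by blast
qed

text \<open>
  With equal system times \<open>q\<close>, list scheduling starts every job at a multiple of \<open>q\<close> and uses
  at most \<open>\<lceil>n / |S|\<rceil>\<close> rounds, whereas every schedule needs at least \<open>\<lceil>n / \<alpha>\<^sub>1\<rceil>\<close> of them.
\<close>

lemma equal_times_ratio:
  assumes \<gamma>: "\<gamma> \<ge> 1" and I: "smc I" and ex: "exclusive I"
    and q: "\<And>j. j \<in> jobs I \<Longrightarrow> system_time I j = q"
    and S: "approx_max_independent \<gamma> I S"
    and \<sigma>: "is_list_schedule I S \<sigma>" "conflict_free I \<sigma>"
  shows "makespan I \<sigma> \<le> of_int \<lceil>\<gamma>\<rceil> * opt_makespan I"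
proof -
  note S = approx_max_independentD[OF \<gamma> I S]
  define g where "g = nat \<lceil>\<gamma>\<rceil>"
  have g: "\<gamma> \<le> real g" "real g = of_int \<lceil>\<gamma>\<rceil>"
    using \<gamma> by (auto simp: g_def)
  have opt_nonneg: "opt_makespan I \<ge> 0"
    using opt_makespan_ge[OF \<sigma>(2), of 0] makespan_nonneg by blast
  have "completion I \<sigma> j \<le> real g * opt_makespan I" if j: "j \<in> jobs I" for j
  proof -
    let ?q = "of_rat q :: real"
    \<comment> \<open>The number of jobs before \<open>j\<close> on its machine, so that
      \<open>j\<close> runs in round \<open>Suc ?k\<close>.\<close>
    let ?k = "load (machine \<sigma>) (\<lambda>_. 1 :: nat) j (machine \<sigma> j)"
    have n: "j < num_jobs I"
      using j by (simp add: jobs_def)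
    have q_nonneg: "?q \<ge> 0"
      using system_time_nonneg[OF I j] q[OF j] by simp
    have loads: "load (machine \<sigma>) (\<lambda>j. of_rat (system_time I j)) i v
        = ?q * real (load (machine \<sigma>) (\<lambda>_. 1 :: nat) i v)" if "i \<le> num_jobs I" for i v
      using that q by (auto simp: load_def sum_distrib_left jobs_def intro!: sum.cong)
    define K where "K = (num_jobs I - 1) div alpha1 I"
    have \<alpha>: "alpha1 I \<ge> 1"
      by (rule alpha1_pos[OF I])
    have "K * alpha1 I \<le> num_jobs I - 1"
      by (simp add: K_def)
    then have "K * alpha1 I < num_jobs I"
      using n by linarith
    then have opt: "real (Suc K) * ?q \<le> opt_makespan I"
      using q by (intro opt_makespan_ge[OF \<sigma>(2)] makespan_ge_mult[OF _ ex]) auto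
    have "num_jobs I - 1 < Suc K * alpha1 I"
      using \<alpha> dividend_less_times_div[of "alpha1 I" "num_jobs I - 1"] by (simp add: K_def mult.commute)
    then have nK: "num_jobs I \<le> Suc K * alpha1 I"
      by linarith
    have "real (card S) * load (machine \<sigma>) (\<lambda>j. of_rat (system_time I j)) j (machine \<sigma> j)
        \<le> (\<Sum>i<j. of_rat (system_time I i))"
      using \<sigma>(1) by (intro list_schedule_load_le_average[OF _ S(2) n]) (simp add: is_list_schedule_def)
    also have "\<dots> = (\<Sum>i<j. ?q)"
      using n q by (intro sum.cong) (auto simp: jobs_def)
    finally have "?q * (real (card S) * real ?k) \<le> ?q * real j"
      using n by (simp add: loads mult_ac)
    have "?q * real (Suc ?k) \<le> ?q * (real g * real (Suc K))"
    proof (cases "?q = 0")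
      case False
      with q_nonneg \<open>?q * (real (card S) * real ?k) \<le> ?q * real j\<close>
      have "real (card S) * real ?k \<le> real j"
        by (simp add: mult_le_cancel_left)
      also have "\<dots> < real (num_jobs I)"
        using n by simp
      also have "\<dots> \<le> real (Suc K) * real (alpha1 I)"
        using nK by (simp only: of_nat_le_iff flip: of_nat_mult)
      also have "\<dots> \<le> real (Suc K) * (real g * real (card S))"
        using S(4) g(1) by (intro mult_left_mono order.trans[OF S(4)] mult_right_mono) auto
      \<comment> \<open>Here the ceiling enters: as \<open>g\<close> is an integer, cancelling
        \<open>card S\<close> leaves a strict inequality of natural numbers, which yields the extra
        round for \<open>j\<close> itself.\<close>
      finally have "card S * ?k < card S * (g * Suc K)"
        by (simp only: mult_ac of_nat_less_iff flip: of_nat_mult)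
      then have "Suc ?k \<le> g * Suc K"
        by simp
      then have "real (Suc ?k) \<le> real g * real (Suc K)"
        by (simp only: of_nat_le_iff flip: of_nat_mult)
      then show ?thesis
        using q_nonneg by (rule mult_left_mono)
    qed simp
    also have "\<dots> \<le> real g * opt_makespan I"
      using mult_left_mono[OF opt, of "real g"] by (simp only: mult_ac of_nat_0_le_iff)
    finally show ?thesis
      using is_list_schedule_completion[OF \<sigma>(1) j] loads[of "Suc j" "machine \<sigma> j"] n
      by (simp add: load_Suc)
  qed
  then show ?thesis
    using opt_nonneg unfolding g(2)[symmetric] by (intro makespan_le) auto
qed

text \<open>Graham's argument: job \<open>j\<close> starts no later than the work of the other jobs
  divided by \<open>card S\<close>. The total work is at most \<open>\<gamma> * card S\<close> times
  the optimum, and the system time of \<open>j\<close>, which remains with coefficient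
  \<open>1 - 1 / card S\<close>, is at most the optimum.\<close>

lemma list_scheduling_ratio:
  assumes \<gamma>: "\<gamma> \<ge> 1" and I: "smc I" and ex: "exclusive I"
    and S: "approx_max_independent \<gamma> I S"
    and \<sigma>: "is_list_schedule I S \<sigma>" "conflict_free I \<sigma>"
  shows "makespan I \<sigma> \<le> (\<gamma> + 1 - 1 / real (num_machines I)) * opt_makespan I"
proof -
  note S = approx_max_independentD[OF \<gamma> I S]
  let ?q = "\<lambda>j. of_rat (system_time I j) :: real"
  let ?opt = "opt_makespan I" and ?c = "real (card S)" and ?m = "real (num_machines I)"
  have c: "?c > 0" "?c \<ge> 1" "?c \<le> ?m"
    using S(3,5) by auto
  have opt_nonneg: "?opt \<ge> 0"
    using opt_makespan_ge[OF \<sigma>(2), of 0] makespan_nonneg by blast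
  have total: "(\<Sum>j\<in>jobs I. ?q j) \<le> \<gamma> * ?c * ?opt"
  proof -
    have \<alpha>: "real (alpha1 I) > 0"
      using alpha1_pos[OF I] by simp
    have "(\<Sum>j\<in>jobs I. ?q j) / alpha1 I \<le> ?opt"
      using sum_system_time_le[OF I _ ex] \<alpha>
      by (intro opt_makespan_ge[OF \<sigma>(2)]) (simp add: field_simps)
    then have "(\<Sum>j\<in>jobs I. ?q j) \<le> alpha1 I * ?opt"
      using \<alpha> by (simp add: field_simps)
    also have "\<dots> \<le> \<gamma> * ?c * ?opt"
      using S(4) opt_nonneg by (rule mult_right_mono)
    finally show ?thesis .
  qed
  have inv: "1 / ?m \<le> 1 / ?c" "1 / ?c \<le> 1"
    using c by (auto simp: frac_le)
  have "completion I \<sigma> j \<le> (\<gamma> + 1 - 1 / ?m) * ?opt" if j: "j \<in> jobs I" for j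
  proof -
    have n: "j < num_jobs I"
      using j by (simp add: jobs_def)
    have q_nonneg: "?q k \<ge> 0" if "k \<in> jobs I" for k
      using system_time_nonneg[OF I that] by simp
    have "?q j \<le> makespan I \<tau>" if "conflict_free I \<tau>" for \<tau>
      using completion_le_makespan[OF j, of \<tau>] that j by (auto simp: completion_def conflict_free_def)
    then have q_opt: "?q j \<le> ?opt"
      by (intro opt_makespan_ge[OF \<sigma>(2)])
    have "?c * start \<sigma> j \<le> (\<Sum>k<j. ?q k)"
      using list_schedule_load_le_average[OF _ S(2) n, of ?q "machine \<sigma>"] \<sigma>(1) j
      by (simp add: is_list_schedule_def)
    then have "?c * start \<sigma> j + ?q j \<le> (\<Sum>k<Suc j. ?q k)"
      by simp
    also have "\<dots> \<le> (\<Sum>j\<in>jobs I. ?q j)"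
      unfolding jobs_def using n q_nonneg by (intro sum_mono2) (auto simp: jobs_def)
    also note total
    finally have "start \<sigma> j \<le> (\<gamma> * ?c * ?opt - ?q j) / ?c"
      using c by (simp add: field_simps)
    also have "\<dots> = \<gamma> * ?opt - 1 / ?c * ?q j"
      using c by (simp add: field_simps)
    finally have "completion I \<sigma> j \<le> \<gamma> * ?opt + (1 - 1 / ?c) * ?q j"
      by (simp add: completion_def algebra_simps)
    \<comment> \<open>Both factors grow: \<open>card S\<close> is at most the number of machines,
      and the system time of \<open>j\<close> is at most the optimum.\<close>
    also have "\<dots> \<le> \<gamma> * ?opt + (1 - 1 / ?m) * ?opt"
      using inv q_opt q_nonneg[OF j] by (intro add_left_mono mult_mono) auto
    finally show ?thesis
      by (simp add: algebra_simps)
  qed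
  moreover have "(\<gamma> + 1 - 1 / ?m) * ?opt \<ge> 0"
    using \<gamma> inv opt_nonneg by (intro mult_nonneg_nonneg) auto
  ultimately show ?thesis
    by (intro makespan_le)
qed

theorem theorem2p4:
  fixes \<gamma> :: real
  assumes "\<gamma> \<ge> 1"
  shows "(\<exists>c. approximation \<gamma> prop_I (\<lambda>I. of_int \<lceil>\<gamma>\<rceil>) c) \<and>
         (\<exists>c. approximation \<gamma> prop_II (\<lambda>I. of_int \<lceil>\<gamma>\<rceil>) c) \<and>
         (\<exists>c. approximation \<gamma> prop_III (\<lambda>I. \<gamma> + 1 - 1 / real (num_machines I)) c)"
proof (intro conjI exI)
  show "approximation \<gamma> prop_I (\<lambda>I. of_int \<lceil>\<gamma>\<rceil>) list_scheduling"
  proof (rule approximation_list_scheduling[OF assms])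
    fix I S \<sigma>
    assume *: "smc I" "prop_I I" "approx_max_independent \<gamma> I S" "is_list_schedule I S \<sigma>"
      "conflict_free I \<sigma>"
    then obtain q where "\<And>j. j \<in> jobs I \<Longrightarrow> system_time I j = q"
      by (auto simp: prop_I_def system_time_def)
    then show "makespan I \<sigma> \<le> of_int \<lceil>\<gamma>\<rceil> * opt_makespan I"
      using equal_times_ratio[OF assms *(1) prop_I_exclusive[OF *(1,2)] _ *(3-5)] by blast
  qed
  show "approximation \<gamma> prop_II (\<lambda>I. of_int \<lceil>\<gamma>\<rceil>) list_scheduling"
  proof (rule approximation_list_scheduling[OF assms])
    fix I S \<sigma>
    assume *: "smc I" "prop_II I" "approx_max_independent \<gamma> I S" "is_list_schedule I S \<sigma>"
      "conflict_free I \<sigma>"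
    then obtain q where "\<And>j. j \<in> jobs I \<Longrightarrow> system_time I j = q"
      by (auto simp: prop_II_def)
    then show "makespan I \<sigma> \<le> of_int \<lceil>\<gamma>\<rceil> * opt_makespan I"
      using equal_times_ratio[OF assms *(1) prop_II_exclusive[OF *(1,2)] _ *(3-5)] by blast
  qed
  show "approximation \<gamma> prop_III (\<lambda>I. \<gamma> + 1 - 1 / real (num_machines I)) list_scheduling"
    by (rule approximation_list_scheduling[OF assms])
      (rule list_scheduling_ratio[OF assms _ prop_III_exclusive])
qed

end
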